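(* Let $k$ be an algebraically closed field and $Q_3$ the $3$-Kronecker quiver (two vertices $x,y$, three arrows from $x$ to $y$). Let $M$ be an indecomposable, non-simple $Q_3$-representation over $k$ with $\dim_k M\le 6$. Then there exists an exact sequence $$0\longrightarrow U_1\longrightarrow M\longrightarrow U_2\longrightarrow 0$$ of $Q_3$-representations such that $U_1$ and $U_2$ are indecomposable and at least one of them is simple.
   Context: Here $\dim_kM=\dim_kM(x)+\dim_kM(y)$. *)

theory Defs
  imports "HOL-Computational_Algebra.Polynomial"
begin

text \<open>
  A vector space over \<open>k\<close> is given as a subspace of an ambient type carrying a vector space
  structure (every vector space is a subspace of itself). Functions are only constrained on
  the relevant subspaces; their values elsewhere are junk.
\<close>

definition linear_between ::
  "('k::field \<Rightarrow> 'a::ab_group_add \<Rightarrow> 'a) \<Rightarrow> ('k \<Rightarrow> 'b::ab_group_add \<Rightarrow> 'b) \<Rightarrow>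
   'a set \<Rightarrow> 'b set \<Rightarrow> ('a \<Rightarrow> 'b) \<Rightarrow> bool" where
  "linear_between s t V W f \<longleftrightarrow>
     f ` V \<subseteq> W \<and>
     (\<forall>u\<in>V. \<forall>v\<in>V. f (u + v) = f u + f v) \<and>
     (\<forall>c. \<forall>v\<in>V. f (s c v) = t c (f v))"

datatype arrow = Arrow1 | Arrow2 | Arrow3

record ('a, 'b) krep =
  space_x :: "'a set"
  space_y :: "'b set"
  act :: "arrow \<Rightarrow> 'a \<Rightarrow> 'b"

locale kronecker3 = vector_space_pair sx sy
  for sx :: "'k::field \<Rightarrow> 'a::ab_group_add \<Rightarrow> 'a"
  and sy :: "'k \<Rightarrow> 'b::ab_group_add \<Rightarrow> 'b"
begin

definition is_rep :: "('a, 'b) krep \<Rightarrow> bool" where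
  "is_rep M \<longleftrightarrow>
     vs1.subspace (space_x M) \<and> vs2.subspace (space_y M) \<and>
     (\<forall>\<gamma>. linear_between sx sy (space_x M) (space_y M) (act M \<gamma>))"

text \<open>\<^const>\<open>vs1.dim\<close> is 0 on infinite-dimensional spaces, so bounds on \<open>dim_rep\<close> are only
  meaningful together with \<open>fin_dim\<close>.\<close>

definition fin_dim :: "('a, 'b) krep \<Rightarrow> bool" where
  "fin_dim M \<longleftrightarrow>
     (\<exists>B. finite B \<and> vs1.span B = space_x M) \<and> (\<exists>B. finite B \<and> vs2.span B = space_y M)"

definition dim_rep :: "('a, 'b) krep \<Rightarrow> nat" where
  "dim_rep M = vs1.dim (space_x M) + vs2.dim (space_y M)"

definition is_zero :: "('a, 'b) krep \<Rightarrow> bool" where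
  "is_zero M \<longleftrightarrow> space_x M = {0} \<and> space_y M = {0}"

definition subrep :: "('a, 'b) krep \<Rightarrow> ('a, 'b) krep \<Rightarrow> bool" where
  "subrep N M \<longleftrightarrow>
     is_rep N \<and> is_rep M \<and> space_x N \<subseteq> space_x M \<and> space_y N \<subseteq> space_y M \<and>
     (\<forall>\<gamma>. \<forall>v\<in>space_x N. act N \<gamma> v = act M \<gamma> v)"

definition simple :: "('a, 'b) krep \<Rightarrow> bool" where
  "simple M \<longleftrightarrow>
     is_rep M \<and> \<not> is_zero M \<and>
     (\<forall>N. subrep N M \<longrightarrow> is_zero N \<or> (space_x N = space_x M \<and> space_y N = space_y M))"

definition direct_sum :: "('a, 'b) krep \<Rightarrow> ('a, 'b) krep \<Rightarrow> ('a, 'b) krep \<Rightarrow> bool" where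
  "direct_sum M N1 N2 \<longleftrightarrow>
     subrep N1 M \<and> subrep N2 M \<and>
     space_x N1 \<inter> space_x N2 = {0} \<and> space_y N1 \<inter> space_y N2 = {0} \<and>
     space_x M = {u + v | u v. u \<in> space_x N1 \<and> v \<in> space_x N2} \<and>
     space_y M = {u + v | u v. u \<in> space_y N1 \<and> v \<in> space_y N2}"

definition indecomposable :: "('a, 'b) krep \<Rightarrow> bool" where
  "indecomposable M \<longleftrightarrow>
     is_rep M \<and> \<not> is_zero M \<and>
     (\<forall>N1 N2. direct_sum M N1 N2 \<longrightarrow> is_zero N1 \<or> is_zero N2)"

definition rep_hom ::
  "('a, 'b) krep \<Rightarrow> ('a, 'b) krep \<Rightarrow> ('a \<Rightarrow> 'a) \<times> ('b \<Rightarrow> 'b) \<Rightarrow> bool" where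
  "rep_hom M N f \<longleftrightarrow>
     is_rep M \<and> is_rep N \<and>
     linear_between sx sx (space_x M) (space_x N) (fst f) \<and>
     linear_between sy sy (space_y M) (space_y N) (snd f) \<and>
     (\<forall>\<gamma>. \<forall>v\<in>space_x M. snd f (act M \<gamma> v) = act N \<gamma> (fst f v))"

text \<open>
  All three terms live in the same ambient spaces. This is no restriction on the existence of
  sequences with given middle term: a quotient of \<open>M\<close> can be realised on complements, in the
  ambient spaces, of the subspaces divided out.
\<close>

definition short_exact ::
  "('a, 'b) krep \<Rightarrow> ('a \<Rightarrow> 'a) \<times> ('b \<Rightarrow> 'b) \<Rightarrow> ('a, 'b) krep \<Rightarrow>
   ('a \<Rightarrow> 'a) \<times> ('b \<Rightarrow> 'b) \<Rightarrow> ('a, 'b) krep \<Rightarrow> bool" where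
  "short_exact U1 f M g U2 \<longleftrightarrow>
     rep_hom U1 M f \<and> rep_hom M U2 g \<and>
     inj_on (fst f) (space_x U1) \<and> inj_on (snd f) (space_y U1) \<and>
     fst f ` space_x U1 = {v \<in> space_x M. fst g v = 0} \<and>
     snd f ` space_y U1 = {v \<in> space_y M. snd g v = 0} \<and>
     fst g ` space_x M = space_x U2 \<and> snd g ` space_y M = space_y U2"

end

end

theory Submission
  imports Defs
begin

text \<open>
  Write \<open>(V, W)\<close> for the two spaces of \<open>M\<close>, \<open>E\<close> for the span of the arrows, and call
  \<open>dim E v\<close> the rank of \<open>v \<in> V\<close>. A simple term of the sequence amounts to a hyperplane \<open>H\<close> of \<open>V\<close>
  with \<open>(H, W)\<close> indecomposable, or to a line \<open>L\<close> of \<open>W\<close> with \<open>(V, W/L)\<close> indecomposable. Transposing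
  the arrows exchanges the two options, so \<open>dim V \<le> dim W\<close> may be assumed.

  If \<open>(V, W)\<close> decomposes and \<open>E V = W\<close>, then there are independent \<open>u\<close>, \<open>u'\<close> with
  \<open>E u \<inter> E u' = 0\<close>. This settles \<open>dim V = 1\<close> (any line), dimensions (2,2) (there is a vector of
  rank 2) and (2,4) (a line outside \<open>E v\<close> for the at most one \<open>v\<close> of rank 2 works). In dimensions
  (2,3) one may assume that all ranks are 2, and a line contained in \<open>E v\<close> for only one \<open>v\<close> up to
  scalars works. In dimensions (3,3) a suitable hyperplane always exists: otherwise the
  vectors of rank 1 fill a plane \<open>P\<close>, on which the arrows either share a one-dimensional image or
  are proportional to a single map, and both lead to a decomposition of \<open>(V, W)\<close>.
\<close>

section \<open>Finitely spanned subspaces\<close>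

text \<open>Two complementary tools carry every case. Indecomposability of \<open>M\<close> enters
  as \<open>E V = W\<close> and as the strict inequality
  \<open>dim W < dim (E V1) + dim (E V2)\<close> for every splitting of \<open>V\<close> into
  nonzero summands. Indecomposability of the smaller representation follows by excluding independent
  \<open>u\<close>, \<open>u'\<close> whose images meet only inside the line divided out (inside 0
  for a hyperplane). Everything thus turns on ranks and on intersections of two images. If
  \<open>dim V = 2\<close>, the inequality makes the images of independent vectors meet
  nontrivially, so a line \<open>L\<close> can fail only by being equal to such an intersection. The
  obstacle is (2,3): the spoiled lines come from all pairs of vectors, a two-parameter family in a
  three-dimensional \<open>W\<close>. Restricting to lines inside one fixed image \<open>S\<close>
  leaves the one-parameter family \<open>S \<inter> E u\<close>, and it remains to see that this
  family does not exhaust the lines of \<open>S\<close>. Closedness of the field enters there, as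
  the assumption \<open>quad\<close>: a monic quadratic takes a value other than a prescribed
  one.\<close>

text \<open>A locale of its own because \<open>vector_space\<close> is globally interpreted for real vector spaces,
  so that a constant defined inside \<open>vector_space\<close> is shadowed by its real instance.\<close>

locale fin_space = vector_space
begin

text \<open>The ambient space may be infinite-dimensional and \<open>dim\<close> is 0 on sets with
  infinite-dimensional span, so finiteness is carried by each set separately.\<close>

definition fin_spanned :: "'b set \<Rightarrow> bool" where
  "fin_spanned S \<longleftrightarrow> (\<exists>B. finite B \<and> S \<subseteq> span B)"

lemma span_subspace_id [simp]: "subspace S \<Longrightarrow> span S = S"
  by simp

lemma span_single_eq:
  assumes "u \<noteq> 0" "u \<in> span {x}"
  shows "span {u} = span {x}"
proof -
  obtain c where c: "u = scale c x" using assms span_singleton by blast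
  then have "c \<noteq> 0" using assms by auto
  then have "x = scale (inverse c) u" using c by simp
  then show ?thesis
    using assms(2) span_eq[of "{u}" "{x}"] span_scale span_base by auto
qed

lemma span_single_Int:
  assumes "x \<notin> span {u}"
  shows "span {u} \<inter> span {x} = {0}"
proof -
  have "z = 0" if "z \<in> span {u}" "z \<in> span {x}" for z
    using span_single_eq[of z u] span_single_eq[of z x] that assms span_base[of x "{x}"] by auto
  then show ?thesis using span_zero by blast
qed

lemma fin_spanned_mono: "fin_spanned T \<Longrightarrow> S \<subseteq> span T \<Longrightarrow> fin_spanned S"
  unfolding fin_spanned_def by (meson span_minimal subset_trans subspace_span)

lemma fin_spanned_subset: "fin_spanned T \<Longrightarrow> S \<subseteq> T \<Longrightarrow> fin_spanned S"
  unfolding fin_spanned_def by blast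

lemma fin_spanned_finite: "finite S \<Longrightarrow> fin_spanned S"
  unfolding fin_spanned_def using span_superset by blast

lemma fin_spanned_span [simp]: "fin_spanned (span S) \<longleftrightarrow> fin_spanned S"
  by (meson fin_spanned_mono fin_spanned_subset order_refl span_superset)

lemma fin_spanned_basis:
  assumes "fin_spanned S"
  obtains B where "B \<subseteq> S" "finite B" "independent B" "span B = span S" "card B = dim S"
proof -
  obtain B where B: "B \<subseteq> S" "independent B" "S \<subseteq> span B" "card B = dim S"
    using basis_exists by blast
  obtain C where C: "finite C" "S \<subseteq> span C"
    using assms unfolding fin_spanned_def by blast
  have "finite B"
    using independent_span_bound[OF C(1) B(2)] B(1) C(2) by blast
  moreover have "span B = span S"
    using B(1,3) span_eq span_superset by blast
  ultimately show ?thesis using that B by blast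
qed

lemma dim_insert_fin:
  assumes "fin_spanned S"
  shows "dim (insert x S) = (if x \<in> span S then dim S else Suc (dim S))"
proof (cases "x \<in> span S")
  case True
  then show ?thesis by (metis span_redundant dim_span)
next
  case False
  obtain B where B: "B \<subseteq> S" "finite B" "independent B" "span B = span S" "card B = dim S"
    using fin_spanned_basis[OF assms] .
  have "independent (insert x B)"
    using B False by (simp add: independent_insertI)
  moreover have "span (insert x B) = span (insert x S)"
    using B(4) by (simp add: span_insert)
  moreover have "card (insert x B) = Suc (dim S)"
    using B False span_superset[of B] by (metis card_insert_disjoint subsetD)
  ultimately show ?thesis
    using dim_eq_card False by simp
qed

lemma dim_mono_fin:
  assumes "fin_spanned T" "S \<subseteq> span T"
  shows "dim S \<le> dim T"
proof -
  obtain B where "B \<subseteq> T" "finite B" "independent B" "span B = span T" "card B = dim T"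
    using fin_spanned_basis[OF assms(1)] .
  then show ?thesis using dim_le_card[of S B] assms(2) by simp
qed

lemma subspace_eq_fin:
  assumes "fin_spanned T" "subspace S" "S \<subseteq> T" "dim T \<le> dim S"
  shows "S = T"
proof (rule ccontr)
  assume "S \<noteq> T"
  then obtain x where x: "x \<in> T" "x \<notin> S" using assms(3) by blast
  have "fin_spanned S" using assms(1,3) fin_spanned_subset by blast
  then have "dim (insert x S) = Suc (dim S)"
    using dim_insert_fin[of S x] x assms(2) by (simp add: span_subspace_id)
  moreover have "dim (insert x S) \<le> dim T"
    using assms(1) dim_mono_fin x assms(3) span_superset by (metis insert_subset subset_trans)
  ultimately show False using assms(4) by simp
qed

lemma dim_eq_0_fin: "fin_spanned S \<Longrightarrow> dim S = 0 \<longleftrightarrow> S \<subseteq> {0}"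
proof
  assume S: "fin_spanned S" "dim S = 0"
  then obtain B where "finite B" "span B = span S" "card B = 0"
    using fin_spanned_basis by metis
  then show "S \<subseteq> {0}" using span_superset[of S] by auto
next
  assume "S \<subseteq> {0}"
  then show "dim S = 0" using dim_le_card[of S "{}"] by simp
qed

lemma dim_empty_fin [simp]: "dim {} = 0"
  using dim_le_card[of "{}" "{}"] by simp

lemma dim_0_fin [simp]: "dim {0} = 0"
  using dim_le_card[of "{0}" "{}"] by simp

lemma dim_singleton_fin: "dim {x} = (if x = 0 then 0 else 1)"
  using dim_insert_fin[of "{}" x] fin_spanned_finite by simp

lemma independent_Un_disjoint:
  assumes "independent B" "finite D" "independent D" "span B \<inter> span D = {0}"
  shows "independent (B \<union> D) \<and> B \<inter> D = {}"
  using assms(2-)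
proof (induction D rule: finite_induct)
  case empty
  then show ?case using assms(1) by simp
next
  case (insert d D)
  have D: "independent D" "d \<notin> span D"
    using insert.prems(1) insert.hyps(2) independent_insert by auto
  have "span D \<subseteq> span (insert d D)" by (simp add: span_mono subset_insertI)
  then have 0: "span B \<inter> span D = {0}"
    using insert.prems(2) span_zero by blast
  have "d \<notin> span (B \<union> D)"
  proof
    assume "d \<in> span (B \<union> D)"
    then obtain b e where be: "d = b + e" "b \<in> span B" "e \<in> span D"
      unfolding span_Un by blast
    have "d - e \<in> span (insert d D)"
      using be(3) \<open>span D \<subseteq> _\<close> by (meson insertI1 span_base span_diff subsetD)
    then have "b \<in> span B \<inter> span (insert d D)" using be by simp
    then have "b = 0" using insert.prems(2) by blast
    then show False using be D by simp
  qed
  moreover from this have "d \<notin> B" using span_base by blast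
  ultimately show ?case
    using insert.IH[OF D(1) 0] by (simp add: independent_insertI)
qed

lemma dim_Un_disjoint:
  assumes "fin_spanned S" "fin_spanned T" "subspace S" "subspace T" "S \<inter> T = {0}"
  shows "dim (S \<union> T) = dim S + dim T"
proof -
  obtain B where B: "B \<subseteq> S" "finite B" "independent B" "span B = span S" "card B = dim S"
    using fin_spanned_basis[OF assms(1)] .
  obtain D where D: "D \<subseteq> T" "finite D" "independent D" "span D = span T" "card D = dim T"
    using fin_spanned_basis[OF assms(2)] .
  have "span B \<inter> span D = {0}" using assms(3-5) B(4) D(4) by (metis span_eq_iff)
  then have "independent (B \<union> D)" "B \<inter> D = {}"
    using independent_Un_disjoint B(3) D(2,3) by blast+
  moreover have "span (B \<union> D) = span (S \<union> T)" using B(4) D(4) by (simp add: span_Un)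
  ultimately show ?thesis
    using dim_eq_card[of "B \<union> D" "S \<union> T"] card_Un_disjoint[OF B(2) D(2)] B(5) D(5) by simp
qed

lemma complement_exists:
  assumes "subspace S" "subspace T" "S \<subseteq> T"
  obtains C where "subspace C" "C \<subseteq> T" "S \<inter> C = {0}" "span (S \<union> C) = T"
proof -
  obtain B where B: "B \<subseteq> S" "independent B" "S \<subseteq> span B"
    using maximal_independent_subset by blast
  obtain D where D: "B \<subseteq> D" "D \<subseteq> T" "independent D" "T \<subseteq> span D"
    using maximal_independent_subset_extend[of B T] B assms(3) by blast
  define C where "C = span (D - B)"
  have SB: "S = span B" using B assms(1) span_minimal by blast
  have TD: "T = span D" using D assms(2) span_minimal by blast
  have "S \<inter> C \<subseteq> {0}"
  proof
    fix x assume "x \<in> S \<inter> C"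
    then have x: "x \<in> span B" "x \<in> span (D - B)" using SB C_def by auto
    \<comment> \<open>The coordinates of \<open>x\<close> over \<open>D\<close> are supported in
      \<open>B\<close> and also in \<open>D - B\<close>, so all of them vanish.\<close>
    have "representation B x = representation D x"
      using representation_extend[OF D(3) x(1) D(1)] by simp
    moreover have "representation (D - B) x = representation D x"
      using representation_extend[OF D(3) x(2)] by simp
    ultimately have "representation D x b = 0" for b
      using representation_ne_zero by (metis DiffE)
    then have "x = 0"
      using sum_nonzero_representation_eq[OF D(3), of x] x(1) D(1) span_mono
      by (metis (mono_tags, lifting) empty_Collect_eq subsetD sum.empty)
    then show "x \<in> {0}" by simp
  qed
  moreover have "0 \<in> S \<inter> C" using SB C_def span_zero by auto
  moreover have "span (S \<union> C) = T"
    using span_Un[of B "D - B"] span_Un[of "span B" "span (D - B)"] TD SB D(1)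
    unfolding C_def by (simp add: Un_absorb1 span_span)
  ultimately show ?thesis
    using that[of C] span_mono[of "D - B" D] TD unfolding C_def by blast
qed

text \<open>A complement of \<open>S \<inter> T\<close> in \<open>T\<close> is also a complement of
  \<open>S\<close> in the sum of \<open>S\<close> and \<open>T\<close>, so
  \<open>dim_Un_disjoint\<close> applies twice.\<close>

lemma dim_Un_Int:
  assumes "fin_spanned S" "fin_spanned T" "subspace S" "subspace T"
  shows "dim (S \<union> T) + dim (S \<inter> T) = dim S + dim T"
proof -
  obtain C where C: "subspace C" "C \<subseteq> T" "(S \<inter> T) \<inter> C = {0}" "span ((S \<inter> T) \<union> C) = T"
    using complement_exists[of "S \<inter> T" T] assms subspace_inter by (metis Int_lower2)
  have fC: "fin_spanned C" using C(2) assms(2) fin_spanned_subset by blast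
  have fI: "fin_spanned (S \<inter> T)" using assms(2) fin_spanned_subset by blast
  have "dim T = dim (S \<inter> T) + dim C"
    using dim_Un_disjoint[OF fI fC _ C(1,3)] C(4) assms(3,4) subspace_inter dim_span by metis
  moreover have "span (S \<union> T) = span (S \<union> C)"
  proof -
    have "T \<subseteq> span (S \<union> C)"
      using C(4) span_mono[of "S \<inter> T \<union> C" "S \<union> C"] by blast
    then show ?thesis
      using C(2) span_superset[of "S \<union> C"] span_superset[of "S \<union> T"] unfolding span_eq by auto
  qed
  moreover have "S \<inter> C = {0}" using C(2,3) by blast
  ultimately show ?thesis
    using dim_Un_disjoint[OF assms(1) fC assms(3) C(1)] dim_span[of "S \<union> T"] dim_span[of "S \<union> C"]
    by simp
qed

lemma span_Un_eq_fin:
  assumes "fin_spanned W" "subspace W" "S \<subseteq> W" "T \<subseteq> W" "subspace S" "subspace T"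
    "S \<inter> T \<subseteq> {0}" "dim W \<le> dim S + dim T"
  shows "span (S \<union> T) = W"
proof -
  have f: "fin_spanned S" "fin_spanned T" using assms(1,3,4) fin_spanned_subset by blast+
  have "dim (S \<inter> T) = 0"
    using dim_eq_0_fin f(1) assms(7) fin_spanned_subset by blast
  then have "dim (span (S \<union> T)) = dim S + dim T"
    using dim_Un_Int[OF f assms(5,6)] by simp
  then show ?thesis
    using subspace_eq_fin[of W "span (S \<union> T)"] assms span_minimal by simp
qed

lemma intermediate_subspace:
  assumes "fin_spanned V" "subspace S" "subspace V" "S \<subseteq> V" "dim S \<le> n" "n \<le> dim V"
  obtains P where "subspace P" "S \<subseteq> P" "P \<subseteq> V" "dim P = n"
proof -
  have "\<exists>P. subspace P \<and> S \<subseteq> P \<and> P \<subseteq> V \<and> dim P = n"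
    using assms(5,6)
  proof (induction n rule: dec_induct)
    case base
    then show ?case using assms by blast
  next
    case (step n)
    then obtain P where P: "subspace P" "S \<subseteq> P" "P \<subseteq> V" "dim P = n" by auto
    then obtain x where x: "x \<in> V" "x \<notin> P" using step by (metis Suc_n_not_le_n subsetI subset_antisym)
    have "fin_spanned P" using P assms(1) fin_spanned_subset by blast
    then have "dim (insert x P) = Suc n" using dim_insert_fin x P by (simp add: span_subspace_id)
    moreover have "span (insert x P) \<subseteq> V" using x P assms(3) span_minimal by simp
    ultimately show ?case
      using P(2) span_superset[of "insert x P"] by (intro exI[of _ "span (insert x P)"]) auto
  qed
  then show ?thesis using that by blast
qed

lemma span_pair_eq_fin:
  assumes "dim S = 2" "fin_spanned S" "subspace S" "a \<in> S" "b \<in> S" "b \<noteq> 0" "a \<notin> span {b}"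
  shows "span {a, b} = S"
proof -
  have "dim {a, b} = 2"
    using dim_insert_fin[of "{b}" a] fin_spanned_finite[of "{b}"] assms dim_singleton_fin by simp
  then show ?thesis
    using subspace_eq_fin[of S "span {a, b}"] assms span_minimal by simp
qed

lemma subspace_scale_iff:
  assumes "subspace S" "c \<noteq> 0"
  shows "scale c x \<in> S \<longleftrightarrow> x \<in> S"
  using subspace_scale[OF assms(1), of x c] subspace_scale[OF assms(1), of "scale c x" "inverse c"] assms(2)
  by auto

text \<open>Serves to find, at a vector of rank 2, an arrow whose value is a combination of the
  values of the other two.\<close>

lemma dim_le_2_exchange:
  assumes "dim {a, b, c} \<le> 2"
  shows "a \<in> span {b, c} \<or> b \<in> span {a, c} \<or> c \<in> span {a, b}"
proof (rule ccontr)
  assume no: "\<not> ?thesis"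
  have "b \<notin> span {c}" using no span_mono[of "{c}" "{a, c}"] by auto
  moreover have "c \<noteq> 0" using no span_zero by auto
  ultimately have "dim {a, b, c} = 3"
    using no dim_insert_fin[of "{b, c}" a] dim_insert_fin[of "{c}" b] dim_singleton_fin[of c]
    by (simp add: fin_spanned_finite)
  then show False using assms by simp
qed

lemma span_pairE:
  assumes "x \<in> span {a, b}"
  obtains s t where "x = scale s a + scale t b"
proof -
  obtain s where "x - scale s a \<in> span {b}" using assms span_breakdown_eq by blast
  then obtain t where "x - scale s a = scale t b" using span_singleton by auto
  then have "x = scale s a + scale t b" by (simp add: algebra_simps)
  then show ?thesis using that by blast
qed

lemma span_Int_single:
  assumes "subspace S" "x \<notin> S"
  shows "span {x} \<inter> S = {0}"
proof -
  have "z = 0" if "z \<in> span {x}" "z \<in> S" for z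
    using span_single_eq[of z x] that assms span_base[of x "{x}"] span_minimal[of "{z}" S] by auto
  then show ?thesis using span_zero assms subspace_0 by blast
qed

lemma span_Un_span: "span (span S \<union> span T) = span (S \<union> T)"
  by (simp add: span_Un[of S T] span_Un[of "span S"] span_span)

lemma span_pair_Un: "span (span {x} \<union> span {y}) = span {x, y}"
  using span_Un_span[of "{x}" "{y}"] by (simp add: insert_commute)

lemma dim_1E:
  assumes "dim S = 1" "subspace S"
  obtains y where "y \<noteq> 0" "S = span {y}"
proof -
  obtain B where B: "B \<subseteq> S" "independent B" "S \<subseteq> span B" "card B = dim S"
    using basis_exists by blast
  then obtain y where "B = {y}" using assms card_1_singletonE by metis
  then show ?thesis
    using that[of y] B assms span_subspace[of B S] by simp
qed

lemma dim_single_le_1: "dim {x} \<le> 1"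
  by (simp add: dim_singleton_fin)

lemma dim_Un_le:
  assumes "fin_spanned S" "fin_spanned T" "subspace S" "subspace T"
  shows "dim (S \<union> T) \<le> dim S + dim T"
  using dim_Un_Int[OF assms] by simp

lemma add_notin: "subspace S \<Longrightarrow> x \<in> S \<Longrightarrow> y + x \<in> S \<longleftrightarrow> y \<in> S"
  using span_add_eq2[of x S y] by simp

text \<open>The projection is linear on the whole type, so it composes with ambient linear maps
  without side conditions; its values outside the sum of \<open>S\<close> and \<open>C\<close> are
  immaterial.\<close>

lemma projection_exists:
  assumes "subspace S" "subspace C" "fin_spanned C" "S \<inter> C = {0}"
  obtains p where "Vector_Spaces.linear scale scale p" "\<And>x. x \<in> S \<Longrightarrow> p x = 0" "\<And>x. x \<in> C \<Longrightarrow> p x = x"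
proof -
  interpret self: vector_space_pair scale scale by unfold_locales
  obtain B where B: "B \<subseteq> S" "independent B" "S \<subseteq> span B"
    using maximal_independent_subset by blast
  then have SB: "S = span B" using assms(1) span_minimal by blast
  obtain D where D: "D \<subseteq> C" "finite D" "independent D" "span D = C"
    using fin_spanned_basis[OF assms(3)] assms(2) by (metis span_subspace_id)
  have ind: "independent (B \<union> D)" "B \<inter> D = {}"
    using independent_Un_disjoint[OF B(2) D(2,3)] SB D(4) assms(4) by auto
  define p where "p = self.construct (B \<union> D) (\<lambda>b. if b \<in> D then b else 0)"
  have lin: "Vector_Spaces.linear scale scale p"
    unfolding p_def by (rule self.linear_construct[OF ind(1)])
  interpret p: Vector_Spaces.linear scale scale p by (rule lin)
  have pB: "p b = 0" if "b \<in> B" for b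
    using self.construct_basis[OF ind(1), of b] that ind(2) by (auto simp: p_def)
  have pD: "p b = b" if "b \<in> D" for b
    using self.construct_basis[OF ind(1), of b] that by (auto simp: p_def)
  have "p x = 0" if "x \<in> S" for x
    using that unfolding SB
    by (induction rule: span_induct_alt) (auto simp: p.add p.scale pB)
  moreover have "p x = x" if "x \<in> C" for x
    using that unfolding D(4)[symmetric]
    by (induction rule: span_induct_alt) (auto simp: p.add p.scale pD)
  ultimately show ?thesis using that lin by blast
qed

end

section \<open>Triples of linear maps\<close>

locale arrow_maps = v: fin_space sx + w: fin_space sy
  for sx :: "'k::field \<Rightarrow> 'a::ab_group_add \<Rightarrow> 'a"
    and sy :: "'k \<Rightarrow> 'b::ab_group_add \<Rightarrow> 'b" +
  fixes A :: "arrow \<Rightarrow> 'a \<Rightarrow> 'b"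
  assumes linear_A: "Vector_Spaces.linear sx sy (A \<gamma>)"
begin

lemma A_add: "A \<gamma> (x + y) = A \<gamma> x + A \<gamma> y"
  and A_scale: "A \<gamma> (sx c x) = sy c (A \<gamma> x)"
  and A_zero [simp]: "A \<gamma> 0 = 0"
  and A_diff: "A \<gamma> (x - y) = A \<gamma> x - A \<gamma> y"
proof -
  interpret Vector_Spaces.linear sx sy "A \<gamma>" by (rule linear_A)
  show "A \<gamma> (x + y) = A \<gamma> x + A \<gamma> y" "A \<gamma> (sx c x) = sy c (A \<gamma> x)" "A \<gamma> 0 = 0"
    "A \<gamma> (x - y) = A \<gamma> x - A \<gamma> y"
    by (simp_all add: add scale diff)
qed

text \<open>This is the subspace called \<open>E S\<close> in the overview; the rank of
  \<open>x\<close> is \<open>w.dim (img {x})\<close>.\<close>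

definition img :: "'a set \<Rightarrow> 'b set" where
  "img S = w.span (\<Union>\<gamma>. A \<gamma> ` S)"

text \<open>\<open>decomp V W L\<close> says that the representation with spaces \<open>V\<close> and \<open>W/L\<close> decomposes, with the
  summands of \<open>W/L\<close> replaced by their preimages \<open>W1\<close>, \<open>W2\<close> in \<open>W\<close>; no quotient has to be formed.\<close>

definition decomp :: "'a set \<Rightarrow> 'b set \<Rightarrow> 'b set \<Rightarrow> bool" where
  "decomp V W L \<longleftrightarrow> (\<exists>V1 V2 W1 W2.
     v.subspace V1 \<and> v.subspace V2 \<and> w.subspace W1 \<and> w.subspace W2 \<and>
     v.span (V1 \<union> V2) = V \<and> V1 \<inter> V2 = {0} \<and> w.span (W1 \<union> W2) = W \<and> W1 \<inter> W2 = L \<and>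
     (\<forall>\<gamma>. A \<gamma> ` V1 \<subseteq> W1 \<and> A \<gamma> ` V2 \<subseteq> W2) \<and>
     \<not> (V1 = {0} \<and> W1 = L) \<and> \<not> (V2 = {0} \<and> W2 = L))"

text \<open>The first disjunct splits off the simple quotient at \<open>x\<close>, the second one the simple
  subrepresentation at \<open>y\<close>.\<close>

definition peelable :: "'a set \<Rightarrow> 'b set \<Rightarrow> bool" where
  "peelable V W \<longleftrightarrow>
     (\<exists>H x. v.subspace H \<and> x \<notin> H \<and> v.span (insert x H) = V \<and> \<not> decomp H W {0}) \<or>
     (\<exists>y\<in>W. y \<noteq> 0 \<and> \<not> decomp V W (w.span {y}))"

lemma decompI:
  assumes "v.subspace V1" "v.subspace V2" "w.subspace W1" "w.subspace W2"
    "v.span (V1 \<union> V2) = V" "V1 \<inter> V2 = {0}" "w.span (W1 \<union> W2) = W" "W1 \<inter> W2 = L"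
    "\<And>\<gamma> x. x \<in> V1 \<Longrightarrow> A \<gamma> x \<in> W1" "\<And>\<gamma> x. x \<in> V2 \<Longrightarrow> A \<gamma> x \<in> W2"
    "\<not> (V1 = {0} \<and> W1 = L)" "\<not> (V2 = {0} \<and> W2 = L)"
  shows "decomp V W L"
  unfolding decomp_def
proof (intro exI conjI allI)
  show "v.subspace V1" "v.subspace V2" "w.subspace W1" "w.subspace W2"
    "v.span (V1 \<union> V2) = V" "V1 \<inter> V2 = {0}" "w.span (W1 \<union> W2) = W" "W1 \<inter> W2 = L"
    "\<not> (V1 = {0} \<and> W1 = L)" "\<not> (V2 = {0} \<and> W2 = L)"
    by fact+
  show "A \<gamma> ` V1 \<subseteq> W1" "A \<gamma> ` V2 \<subseteq> W2" for \<gamma>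
    using assms(9,10) by auto
qed

lemma subspace_img [simp]: "w.subspace (img S)"
  by (simp add: img_def)

lemma zero_in_img [simp]: "0 \<in> img S"
  by (simp add: img_def w.span_zero)

lemma A_in_img: "x \<in> S \<Longrightarrow> A \<gamma> x \<in> img S"
  unfolding img_def by (rule w.span_base) blast

lemma img_least: "w.subspace T \<Longrightarrow> (\<And>\<gamma> x. x \<in> S \<Longrightarrow> A \<gamma> x \<in> T) \<Longrightarrow> img S \<subseteq> T"
  unfolding img_def by (rule w.span_minimal) auto

lemma img_mono: "S \<subseteq> T \<Longrightarrow> img S \<subseteq> img T"
  by (rule img_least) (auto intro: A_in_img)

lemma img_span [simp]: "img (v.span S) = img S"
proof
  have "A \<gamma> x \<in> img S" if "x \<in> v.span S" for \<gamma> x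
    using that
  proof (induction rule: v.span_induct_alt)
    case base
    then show ?case by simp
  next
    case (step c x y)
    then show ?case
      by (simp add: A_add A_scale A_in_img w.subspace_add w.subspace_scale)
  qed
  then show "img (v.span S) \<subseteq> img S" by (intro img_least) auto
  show "img S \<subseteq> img (v.span S)" by (rule img_mono[OF v.span_superset])
qed

lemma img_Un: "img (S \<union> T) = w.span (img S \<union> img T)"
proof
  show "img (S \<union> T) \<subseteq> w.span (img S \<union> img T)"
    by (rule img_least) (auto intro: A_in_img w.span_base)
  show "w.span (img S \<union> img T) \<subseteq> img (S \<union> T)"
    using img_mono[of S "S \<union> T"] img_mono[of T "S \<union> T"] by (intro w.span_minimal) auto
qed

lemma img_pair: "img {x, y} = w.span (img {x} \<union> img {y})"
  using img_Un[of "{x}" "{y}"] by (simp add: insert_commute)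

lemma UNIV_arrow: "UNIV = {Arrow1, Arrow2, Arrow3}"
  using arrow.exhaust by blast

lemma img_single: "img {x} = w.span {A Arrow1 x, A Arrow2 x, A Arrow3 x}"
  unfolding img_def UNIV_arrow by (simp add: insert_commute)

lemma fin_spanned_img_single [simp]: "w.fin_spanned (img {x})"
  by (simp add: img_single w.fin_spanned_finite)

text \<open>If both \<open>V1\<close> and \<open>V2\<close> are nonzero, vectors \<open>u\<close>,
  \<open>u'\<close> taken from them have images inside \<open>W1\<close> and \<open>W2\<close>,
  which meet in \<open>L\<close>. If one of them is zero, \<open>img V = W\<close> makes the other
  summand fill \<open>W\<close>, and the first is trivial modulo \<open>L\<close>.\<close>

lemma not_decompI:
  assumes img: "img V = W"
    and meet: "\<And>u u'. u \<in> V \<Longrightarrow> u' \<in> V \<Longrightarrow> u \<noteq> 0 \<Longrightarrow> u' \<notin> v.span {u} \<Longrightarrow>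
      \<not> img {u} \<inter> img {u'} \<subseteq> L"
  shows "\<not> decomp V W L"
proof
  assume "decomp V W L"
  then obtain V1 V2 W1 W2 where d:
    "v.subspace V1" "v.subspace V2" "w.subspace W1" "w.subspace W2"
    "v.span (V1 \<union> V2) = V" "V1 \<inter> V2 = {0}" "w.span (W1 \<union> W2) = W" "W1 \<inter> W2 = L"
    "\<forall>\<gamma>. A \<gamma> ` V1 \<subseteq> W1 \<and> A \<gamma> ` V2 \<subseteq> W2"
    "\<not> (V1 = {0} \<and> W1 = L)" "\<not> (V2 = {0} \<and> W2 = L)"
    unfolding decomp_def by (elim exE conjE)
  have i1: "img V1 \<subseteq> W1" using d(3,9) by (intro img_least) blast+
  have i2: "img V2 \<subseteq> W2" using d(4,9) by (intro img_least) blast+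
  have sub: "W1 \<subseteq> W" "W2 \<subseteq> W" "V1 \<subseteq> V" "V2 \<subseteq> V"
    using d(5,7) w.span_superset[of "W1 \<union> W2"] v.span_superset[of "V1 \<union> V2"] by auto
  have W: "W = w.span (img V1 \<union> img V2)"
    using img d(5) img_Un img_span by metis
  have img0: "img {0} = {0}" by (simp add: img_single)
  show False
  proof (cases "V1 = {0} \<or> V2 = {0}")
    case True
    then show False
    proof
      assume V1: "V1 = {0}"
      then have "W = img V2" using W img0 by (simp add: insert_absorb)
      then have "W1 = L" using i2 sub d(8) by blast
      then show False using V1 d(10) by blast
    next
      assume V2: "V2 = {0}"
      then have "W = img V1" using W img0 by (simp add: insert_absorb)
      then have "W2 = L" using i1 sub d(8) by blast
      then show False using V2 d(11) by blast
    qed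
  next
    case False
    then obtain u u' where u: "u \<in> V1" "u \<noteq> 0" "u' \<in> V2" "u' \<noteq> 0"
      using d(1,2) v.subspace_0 by blast
    have "u' \<notin> v.span {u}"
      using u d(1,6) v.span_minimal[of "{u}" V1] by auto
    moreover have "img {u} \<inter> img {u'} \<subseteq> L"
      using i1 i2 d(8) u img_mono[of "{u}" V1] img_mono[of "{u'}" V2] by blast
    ultimately show False using meet u sub by blast
  qed
qed

lemma peelable_hyperplaneI:
  assumes "v.subspace H" "x \<notin> H" "v.span (insert x H) = V" "img H = W"
    and "\<And>u u'. u \<in> H \<Longrightarrow> u' \<in> H \<Longrightarrow> u \<noteq> 0 \<Longrightarrow> u' \<notin> v.span {u} \<Longrightarrow> \<not> img {u} \<inter> img {u'} \<subseteq> {0}"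
  shows "peelable V W"
  unfolding peelable_def using assms not_decompI by blast

end

section \<open>Indecomposable triples and the rank inequality\<close>

locale indecomposable_maps = arrow_maps sx sy A
  for sx :: "'k::field \<Rightarrow> 'a::ab_group_add \<Rightarrow> 'a"
    and sy :: "'k \<Rightarrow> 'b::ab_group_add \<Rightarrow> 'b"
    and A +
  fixes V :: "'a set" and W :: "'b set"
  assumes V: "v.subspace V" "v.fin_spanned V" "V \<noteq> {0}"
    and W: "w.subspace W" "w.fin_spanned W" "W \<noteq> {0}"
    and AV: "A \<gamma> ` V \<subseteq> W"
    and indec: "\<not> decomp V W {0}"
begin

lemma img_subset: "S \<subseteq> V \<Longrightarrow> img S \<subseteq> W"
  using W AV by (intro img_least) auto

lemma fin_spanned_V_subset: "S \<subseteq> V \<Longrightarrow> v.fin_spanned S"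
  using V v.fin_spanned_subset by blast

lemma fin_spanned_W_subset: "S \<subseteq> W \<Longrightarrow> w.fin_spanned S"
  using W w.fin_spanned_subset by blast

text \<open>A complement of \<open>img V\<close> in \<open>W\<close> receives no arrow and would
  split off as a summand with zero space at the source.\<close>

lemma img_V: "img V = W"
proof (rule ccontr)
  assume "img V \<noteq> W"
  obtain C where C: "w.subspace C" "C \<subseteq> W" "img V \<inter> C = {0}" "w.span (img V \<union> C) = W"
    using w.complement_exists[of "img V" W] img_subset W by auto
  have "C \<noteq> {0}"
    using C(4) \<open>img V \<noteq> W\<close> by (auto simp: insert_absorb)
  then have "decomp V W {0}"
    using C V v.subspace_0[OF V(1)]
    by (intro decompI[of V "{0}" "img V" C]) (auto simp: A_in_img insert_absorb w.subspace_0)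
  then show False using indec by blast
qed

text \<open>The two images always span \<open>W\<close>; if their dimensions added up to no more
  than \<open>dim W\<close>, they would meet trivially and split the representation. This is the
  form in which indecomposability drives the dimension counts below.\<close>

lemma rank_sum_gt:
  assumes "v.subspace V1" "v.subspace V2" "v.span (V1 \<union> V2) = V" "V1 \<inter> V2 = {0}"
    "V1 \<noteq> {0}" "V2 \<noteq> {0}"
  shows "w.dim W < w.dim (img V1) + w.dim (img V2)"
proof (rule ccontr)
  assume le: "\<not> ?thesis"
  have sub: "V1 \<subseteq> V" "V2 \<subseteq> V" using assms(3) v.span_superset[of "V1 \<union> V2"] by auto
  have f: "w.fin_spanned (img V1)" "w.fin_spanned (img V2)"
    using sub img_subset fin_spanned_W_subset by auto
  have sp: "w.span (img V1 \<union> img V2) = W"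
    using img_V assms(3) img_Un img_span by metis
  have "w.dim (img V1 \<inter> img V2) = 0"
    using w.dim_Un_Int[OF f] sp le w.dim_span[of "img V1 \<union> img V2"] by simp
  then have "img V1 \<inter> img V2 \<subseteq> {0}"
    using w.dim_eq_0_fin w.fin_spanned_subset[OF f(1)] by blast
  then have int: "img V1 \<inter> img V2 = {0}" by auto
  have "decomp V W {0}"
    using assms sp int by (intro decompI[of V1 V2 "img V1" "img V2"]) (auto simp: A_in_img)
  then show False using indec by blast
qed

text \<open>For a vector of rank 0, a complement of its line would need an image larger than
  \<open>W\<close> by \<open>rank_sum_gt\<close>; if the line is all of \<open>V\<close>, its image
  is the nonzero space \<open>W\<close>.\<close>

lemma rank_pos:
  assumes "x \<in> V" "x \<noteq> 0"
  shows "0 < w.dim (img {x})"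
proof (cases "v.span {x} = V")
  case True
  then have "img {x} = W" using img_V img_span by metis
  then show ?thesis using W w.dim_eq_0_fin w.subspace_0 by blast
next
  case False
  have "v.span {x} \<subseteq> V" using assms V v.span_minimal by simp
  then obtain C where C: "v.subspace C" "C \<subseteq> V" "v.span {x} \<inter> C = {0}"
    "v.span (v.span {x} \<union> C) = V"
    using v.complement_exists[of "v.span {x}" V] V by auto
  have "C \<noteq> {0}"
    using C(4) False by (auto simp: insert_absorb v.span_zero v.span_span)
  moreover have "v.span {x} \<noteq> {0}" using assms v.span_base by blast
  ultimately have "w.dim W < w.dim (img {x}) + w.dim (img C)"
    using rank_sum_gt[of "v.span {x}" C] C by simp
  moreover have "w.dim (img C) \<le> w.dim W"
    using w.dim_mono_fin[of W "img C"] W img_subset[OF C(2)] by simp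
  ultimately show ?thesis by simp
qed

lemma dim_V_pos: "0 < v.dim V" and dim_W_pos: "0 < w.dim W"
  using V W v.dim_eq_0_fin w.dim_eq_0_fin v.subspace_0 w.subspace_0 by blast+

section \<open>Dimensions (1,n), (2,2) and (2,4)\<close>

lemma peelable_dim1:
  assumes "v.dim V = 1"
  shows "peelable V W"
proof -
  obtain y where y: "y \<in> W" "y \<noteq> 0" using W w.subspace_0 by blast
  \<comment> \<open>A line has no independent pair, so the criterion \<open>not_decompI\<close>
    holds vacuously for any \<open>y\<close>, even one that spans \<open>W\<close>.\<close>
  have False if "u \<in> V" "u' \<in> V" "u \<noteq> 0" "u' \<notin> v.span {u}" for u u'
  proof -
    have "v.span {u} = V"
      using v.subspace_eq_fin[of V "v.span {u}"] V that assms v.dim_singleton_fin v.span_minimal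
      by simp
    then show False using that by blast
  qed
  then have "\<not> decomp V W (w.span {y})" using not_decompI img_V by blast
  then show ?thesis using y unfolding peelable_def by blast
qed

lemma independent_pair:
  assumes "1 < v.dim V" "u \<in> V" "u \<noteq> 0"
  obtains u' where "u' \<in> V" "u' \<notin> v.span {u}"
proof -
  have "V \<noteq> v.span {u}"
    using assms v.dim_singleton_fin[of u] by auto
  then show ?thesis
    using that assms(2) V v.span_minimal[of "{u}" V] by auto
qed

lemma span_pair:
  assumes "v.dim V = 2" "u \<in> V" "u' \<in> V" "u \<noteq> 0" "u' \<notin> v.span {u}"
  shows "v.span {u', u} = V"
proof -
  have "v.dim {u', u} = 2"
    using v.dim_insert_fin[of "{u}" u'] v.fin_spanned_finite[of "{u}"] assms v.dim_singleton_fin by simp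
  then show ?thesis
    using v.subspace_eq_fin[of V "v.span {u', u}"] V assms v.span_minimal by simp
qed

text \<open>Two independent vectors split a plane \<open>V\<close>. Together, the inequality and the
  dimension formula say that their images meet in a space of dimension
  \<open>rank u + rank u' - dim W\<close>, which is positive.\<close>

lemma rank_pair:
  assumes "v.dim V = 2" "u \<in> V" "u' \<in> V" "u \<noteq> 0" "u' \<notin> v.span {u}"
  shows "w.dim W < w.dim (img {u}) + w.dim (img {u'})"
    and "w.span (img {u} \<union> img {u'}) = W"
    and "w.dim W + w.dim (img {u} \<inter> img {u'}) = w.dim (img {u}) + w.dim (img {u'})"
proof -
  have sp: "v.span (v.span {u} \<union> v.span {u'}) = V"
    using span_pair[OF assms] v.span_Un[of "{u}" "{u'}"] v.span_Un[of "v.span {u}" "v.span {u'}"]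
    by (simp add: v.span_span insert_commute)
  have "v.span {u} \<inter> v.span {u'} = {0}"
    using v.span_single_Int[OF assms(5)] .
  then show "w.dim W < w.dim (img {u}) + w.dim (img {u'})"
    using rank_sum_gt[of "v.span {u}" "v.span {u'}"] sp assms v.span_zero v.span_base[of _ "{u}"]
      v.span_base[of u' "{u'}"] by auto
  show un: "w.span (img {u} \<union> img {u'}) = W"
    using sp img_V img_span img_Un by metis
  show "w.dim W + w.dim (img {u} \<inter> img {u'}) = w.dim (img {u}) + w.dim (img {u'})"
    using w.dim_Un_Int[of "img {u}" "img {u'}"] w.dim_span[of "img {u} \<union> img {u'}"] un by simp
qed

lemma img_proportional:
  assumes "u \<noteq> 0" "u \<in> v.span {u'}"
  shows "img {u} = img {u'}"
proof -
  show ?thesis using v.span_single_eq[OF assms] img_span by metis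
qed

text \<open>The line through \<open>u\<close> is itself a hyperplane of \<open>V\<close> with image
  \<open>W\<close>, and it contains no independent pair.\<close>

lemma peelable_full_rank:
  assumes "v.dim V = 2" "u \<in> V" "w.dim W \<le> w.dim (img {u})"
  shows "peelable V W"
proof -
  have iW: "img {u} = W"
    using w.subspace_eq_fin[of W "img {u}"] W assms img_subset by auto
  then have "u \<noteq> 0" using W by (auto simp: img_single)
  then obtain x where x: "x \<in> V" "x \<notin> v.span {u}" using independent_pair assms by auto
  have sp: "v.span (insert x (v.span {u})) = V"
    using span_pair[of u x] x assms \<open>u \<noteq> 0\<close> v.span_insert[of x "{u}"] v.span_insert[of x "v.span {u}"]
    by (simp add: v.span_span)
  have "False" if "a \<in> v.span {u}" "b \<in> v.span {u}" "a \<noteq> 0" "b \<notin> v.span {a}" for a b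
    using v.span_single_eq[of a u] that by simp
  then show ?thesis
    using peelable_hyperplaneI[OF v.subspace_span x(2) sp] iW by (metis img_span)
qed

lemma peelable_2_2:
  assumes "v.dim V = 2" "w.dim W = 2"
  shows "peelable V W"
proof -
  obtain u where u: "u \<in> V" "u \<noteq> 0" using V v.subspace_0 by blast
  then obtain u' where u': "u' \<in> V" "u' \<notin> v.span {u}" using independent_pair assms by auto
  have "2 \<le> w.dim (img {u}) \<or> 2 \<le> w.dim (img {u'})"
    using rank_pair(1)[OF assms(1) u(1) u'(1) u(2) u'(2)] assms by auto
  then show ?thesis using peelable_full_rank u u' assms by metis
qed

lemma peelable_2_4:
  assumes "v.dim V = 2" "w.dim W = 4"
  shows "peelable V W"
proof -
  obtain y where y: "y \<in> W" "y \<noteq> 0" "\<And>u. u \<in> V \<Longrightarrow> u \<noteq> 0 \<Longrightarrow> w.dim (img {u}) \<le> 2 \<Longrightarrow> y \<notin> img {u}"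
  proof (cases "\<exists>u\<in>V. u \<noteq> 0 \<and> w.dim (img {u}) \<le> 2")
    case False
    then show ?thesis using that W w.subspace_0 by blast
  next
    case True
    then obtain u where u: "u \<in> V" "u \<noteq> 0" "w.dim (img {u}) \<le> 2" by blast
    then have "img {u} \<noteq> W" using assms by auto
    then obtain y where y: "y \<in> W" "y \<notin> img {u}" using img_subset[of "{u}"] u by blast
    have "y \<notin> img {u'}" if "u' \<in> V" "u' \<noteq> 0" "w.dim (img {u'}) \<le> 2" for u'
    proof -
      \<comment> \<open>Two independent vectors of rank at most 2 would violate
        \<open>4 < rank u + rank u'\<close>.\<close>
      have "u' \<in> v.span {u}"
        using rank_pair(1)[OF assms(1) u(1) that(1) u(2)] u that assms by fastforce
      then show ?thesis using img_proportional that y by blast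
    qed
    moreover have "y \<noteq> 0" using y by auto
    ultimately show ?thesis using that y by blast
  qed
  have "\<not> img {u} \<inter> img {u'} \<subseteq> w.span {y}"
    if u: "u \<in> V" "u' \<in> V" "u \<noteq> 0" "u' \<notin> v.span {u}" for u u'
  proof
    assume sub: "img {u} \<inter> img {u'} \<subseteq> w.span {y}"
    have le: "w.dim (img {u} \<inter> img {u'}) \<le> 1"
      using w.dim_mono_fin[OF w.fin_spanned_finite sub] y w.dim_singleton_fin by simp
    \<comment> \<open>The ranks add up to 4 plus the dimension of the intersection, hence to at most
      5.\<close>
    have "w.dim (img {u}) \<le> 2 \<or> w.dim (img {u'}) \<le> 2"
      using rank_pair(3)[OF assms(1) u] le assms(2) by linarith
    moreover have "w.dim (w.span {y}) \<le> w.dim (img {u} \<inter> img {u'})"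
      using rank_pair(1,3)[OF assms(1) u] y w.dim_singleton_fin by simp
    then have "img {u} \<inter> img {u'} = w.span {y}"
      using w.subspace_eq_fin[OF _ _ sub] w.subspace_inter w.fin_spanned_finite by simp
    then have "y \<in> img {u}" "y \<in> img {u'}" using w.span_base by blast+
    moreover have "u' \<noteq> 0" using u v.span_zero by blast
    ultimately show False using y(3) u by blast
  qed
  then have "\<not> decomp V W (w.span {y})" using not_decompI img_V by blast
  then show ?thesis using y unfolding peelable_def by blast
qed

subsection \<open>Dimensions (2,3)\<close>

text \<open>A vector of rank 3 is covered by \<open>peelable_full_rank\<close>. Otherwise all
  nonzero vectors have rank 2, independent ones have images meeting in a line (2 + 2 - 3 = 1), and
  the line of \<open>y\<close> can fail only if \<open>y\<close> lies in the images of two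
  independent vectors.\<close>

lemma peelable_2_3:
  assumes dV: "v.dim V = 2" and dW: "w.dim W = 3"
    and quad: "\<And>x y z :: 'k. \<exists>t. (x + t) * (y + t) \<noteq> z"
  shows "peelable V W"
proof (cases "\<exists>u\<in>V. 3 \<le> w.dim (img {u})")
  case True
  then show ?thesis using peelable_full_rank assms by metis
next
  case False
  obtain v1 where v1: "v1 \<in> V" "v1 \<noteq> 0" using V v.subspace_0 by blast
  obtain v2 where v2: "v2 \<in> V" "v2 \<notin> v.span {v1}" using independent_pair dV v1 by auto
  have rk: "w.dim (img {u}) = 2" if u: "u \<in> V" "u \<noteq> 0" for u
  proof -
    obtain u' where u': "u' \<in> V" "u' \<notin> v.span {u}" using independent_pair dV u by auto
    have "w.dim (img {u}) \<le> 2" "w.dim (img {u'}) \<le> 2" using False u u' by auto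
    then show ?thesis using rank_pair(1)[OF dV u(1) u'(1) u(2) u'(2)] dW by linarith
  qed
  \<comment> \<open>The line will be spanned by an element of \<open>S\<close> that lies in no \<open>img {p t}\<close>.\<close>
  define S where "S = img {v1}"
  have S: "w.subspace S" "w.fin_spanned S" "w.dim S = 2" "S \<subseteq> W" "S \<noteq> W"
    using rk[OF v1] img_subset[of "{v1}"] v1 dW by (auto simp: S_def)
  \<comment> \<open>The vectors \<open>p t\<close> represent, up to scalars, all lines of
    \<open>V\<close> other than the line of \<open>v1\<close>.\<close>
  define p where "p t = v2 + sx t v1" for t
  have p: "p t \<in> V" "p t \<notin> v.span {v1}" "p t \<noteq> 0" for t
  proof -
    show "p t \<in> V" using v1 v2 V by (simp add: p_def v.subspace_add v.subspace_scale)
    show *: "p t \<notin> v.span {v1}"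
      using v2 v.span_add_eq2[of "sx t v1" "{v1}" v2] by (simp add: p_def v.span_base v.span_scale)
    show "p t \<noteq> 0" using * v.span_zero by auto
  qed
  have notS: "\<not> S \<subseteq> img {p t}" for t
  proof
    assume "S \<subseteq> img {p t}"
    then have "S = img {p t}"
      using w.subspace_eq_fin[of "img {p t}" S] S rk[OF p(1,3)] by simp
    then show False
      using rank_pair(2)[OF dV v1(1) p(1) v1(2) p(2), of t] S by (simp add: S_def)
  qed
  have notpair: "\<not> (x \<in> img {p t} \<and> y \<in> img {p t})"
    if "x \<in> S" "y \<in> S" "y \<noteq> 0" "x \<notin> w.span {y}" for x y t
    using w.span_pair_eq_fin[OF S(3,2,1) that] notS[of t] w.span_minimal[of "{x, y}" "img {p t}"]
    by auto
  have W_eq: "w.span (insert z S) = W" if "z \<in> W" "z \<notin> S" for z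
    using w.subspace_eq_fin[of W "w.span (insert z S)"] W S that dW w.dim_insert_fin[of S z]
      w.span_minimal[of "insert z S" W] by simp
  \<comment> \<open>Such a \<open>y\<close> lies only in the images of multiples of
    \<open>v1\<close>, never in those of two independent vectors.\<close>
  have finish: "peelable V W" if y: "y \<in> S" "y \<noteq> 0" "\<And>t. y \<notin> img {p t}" for y
  proof -
    have out: "y \<notin> img {x}" if x: "x \<in> V" "x \<notin> v.span {v1}" for x
    proof -
      have "x \<in> v.span {v2, v1}" using span_pair[OF dV v1(1) v2(1) v1(2) v2(2)] x by simp
      then obtain s t where st: "x = sx s v2 + sx t v1" by (rule v.span_pairE)
      then have "s \<noteq> 0" using x v.span_base v.span_scale by auto
      then have "x = sx s (p (t / s))" using st by (simp add: p_def v.scale_right_distrib)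
      then have "x \<in> v.span {p (t / s)}" by (simp add: v.span_base v.span_scale)
      moreover have "x \<noteq> 0" using x v.span_zero by auto
      ultimately show ?thesis using img_proportional y(3) by metis
    qed
    have "\<not> img {u} \<inter> img {u'} \<subseteq> w.span {y}"
      if u: "u \<in> V" "u' \<in> V" "u \<noteq> 0" "u' \<notin> v.span {u}" for u u'
    proof
      assume sub: "img {u} \<inter> img {u'} \<subseteq> w.span {y}"
      have "u' \<noteq> 0" using u v.span_zero by auto
      then have "w.dim (img {u} \<inter> img {u'}) = 1"
        using rank_pair(3)[OF dV u] rk u dW by simp
      then have "img {u} \<inter> img {u'} = w.span {y}"
        using w.subspace_eq_fin[OF _ _ sub] w.subspace_inter w.fin_spanned_finite[of "{y}"]
          w.dim_singleton_fin[of y] y by simp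
      then have "y \<in> img {u}" "y \<in> img {u'}" using w.span_base by blast+
      then have "u \<in> v.span {v1}" "u' \<in> v.span {v1}" using out u by blast+
      then show False using v.span_single_eq[of u v1] u by simp
    qed
    then have "\<not> decomp V W (w.span {y})" using not_decompI img_V by blast
    moreover have "y \<in> W" using y S by blast
    ultimately show ?thesis using y unfolding peelable_def by blast
  qed
  define lin where "lin f \<longleftrightarrow> (\<forall>x c y. f (x + sx c y) = f x + sy c (f y))" for f
  have lin_A: "lin (A \<gamma>)" for \<gamma> by (simp add: lin_def A_add A_scale)
  \<comment> \<open>The three arrow values at \<open>v1\<close> lie in the plane \<open>S\<close>,
    so they are dependent. Subtracting the dependence from one arrow gives a combination
    \<open>B\<close> killing \<open>v1\<close> without changing the span of the arrows; then
    \<open>B (p t)\<close> does not depend on \<open>t\<close>.\<close>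
  obtain F G B where FGB: "lin F" "lin G" "lin B" "\<And>x. img {x} = w.span {F x, G x, B x}" "B v1 = 0"
  proof -
    have "w.dim {A Arrow1 v1, A Arrow2 v1, A Arrow3 v1} \<le> 2"
      using S(3) by (simp add: S_def img_single)
    from w.dim_le_2_exchange[OF this]
    obtain g1 g2 g3 where g: "A g3 v1 \<in> w.span {A g1 v1, A g2 v1}" "UNIV = {g1, g2, g3}"
    proof (elim disjE)
      assume "A Arrow1 v1 \<in> w.span {A Arrow2 v1, A Arrow3 v1}"
      then show ?thesis using that[of Arrow1 Arrow2 Arrow3] UNIV_arrow by (simp add: insert_commute)
    next
      assume "A Arrow2 v1 \<in> w.span {A Arrow1 v1, A Arrow3 v1}"
      then show ?thesis using that[of Arrow2 Arrow1 Arrow3] UNIV_arrow by (simp add: insert_commute)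
    next
      assume "A Arrow3 v1 \<in> w.span {A Arrow1 v1, A Arrow2 v1}"
      then show ?thesis using that[of Arrow3 Arrow1 Arrow2] UNIV_arrow by simp
    qed
    then obtain l m where lm: "A g3 v1 = sy l (A g1 v1) + sy m (A g2 v1)"
      using w.span_pairE by blast
    define B where "B x = A g3 x - (sy l (A g1 x) + sy m (A g2 x))" for x
    have "img {x} = w.span {A g1 x, A g2 x, B x}" for x
    proof -
      have "img {x} = w.span {A g1 x, A g2 x, A g3 x}"
        unfolding img_def g(2) by (simp add: insert_commute)
      also have "\<dots> = w.span {A g1 x, A g2 x, B x}"
      proof -
        have i: "sy l (A g1 x) + sy m (A g2 x) \<in> w.span {A g1 x, A g2 x, z}" for z
          by (simp add: w.span_add w.span_scale w.span_base)
        have "B x \<in> w.span {A g1 x, A g2 x, A g3 x}"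
          unfolding B_def by (rule w.span_diff[OF _ i]) (simp add: w.span_base)
        moreover have "B x + (sy l (A g1 x) + sy m (A g2 x)) \<in> w.span {A g1 x, A g2 x, B x}"
          by (rule w.span_add[OF _ i]) (simp add: w.span_base)
        ultimately show ?thesis
          unfolding w.span_eq by (auto simp: B_def w.span_base)
      qed
      finally show ?thesis .
    qed
    moreover have "lin B"
      by (simp add: lin_def B_def A_add A_scale algebra_simps w.scale_right_diff_distrib)
    ultimately show ?thesis using that lin_A lm by (metis B_def diff_self)
  qed
  have F: "F (p t) = F v2 + sy t (F v1)" and G: "G (p t) = G v2 + sy t (G v1)"
    and B: "B (p t) = B v2" for t
    using FGB(1,2,3,5) by (simp_all add: p_def lin_def)
  have in_img: "F x \<in> img {x}" "G x \<in> img {x}" "B x \<in> img {x}" for x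
    using FGB(4) w.span_base by auto
  have in_W: "F x \<in> W" "G x \<in> W" "B x \<in> W" if "x \<in> V" for x
    using in_img[of x] img_subset[of "{x}"] that by auto
  define a b where "a = F v1" and "b = G v1"
  have abS: "a \<in> S" "b \<in> S" using in_img by (auto simp: a_def b_def S_def)
  have S_span: "S = w.span {a, b}"
    using FGB(4)[of v1] FGB(5) by (simp add: S_def a_def b_def insert_commute)
  have ab: "a \<noteq> 0" "b \<noteq> 0" "a \<notin> w.span {b}" "b \<notin> w.span {a}"
  proof -
    have d: "w.dim {a, b} = 2" "w.dim {b, a} = 2" using S(3) by (simp_all add: S_span insert_commute)
    show "a \<noteq> 0" "b \<noteq> 0" using d w.dim_singleton_fin[of b] w.dim_singleton_fin[of a]
      w.dim_span[of "{0, b}"] w.dim_span[of "{0, a}"]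
      by (auto split: if_splits)
    show "a \<notin> w.span {b}" "b \<notin> w.span {a}"
      using d w.dim_insert_fin[of "{b}" a] w.dim_insert_fin[of "{a}" b]
        w.dim_singleton_fin[of b] w.dim_singleton_fin[of a]
      by (auto simp: w.fin_spanned_finite split: if_splits)
  qed
  \<comment> \<open>Otherwise \<open>F\<close> and \<open>G\<close> can be corrected by multiples of \<open>B\<close> so that all their values on \<open>v2\<close>
    lie in \<open>S\<close>; then \<open>img {p t}\<close> contains \<open>S\<close> unless \<open>t\<close> is a root of a quadratic polynomial.\<close>
  have BS: "B v2 \<in> S"
  proof (rule ccontr)
    assume nS: "B v2 \<notin> S"
    note WB = W_eq[OF in_W(3)[OF v2(1)] nS]
    obtain l where l: "F v2 - sy l (B v2) \<in> S"
      using in_W(1)[OF v2(1)] w.span_breakdown_eq[of _ "B v2" S] WB S(1) by auto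
    obtain m where m: "G v2 - sy m (B v2) \<in> S"
      using in_W(2)[OF v2(1)] w.span_breakdown_eq[of _ "B v2" S] WB S(1) by auto
    obtain x1 x2 where x: "F v2 - sy l (B v2) = sy x1 a + sy x2 b"
      using l S_span w.span_pairE by blast
    obtain y1 y2 where y: "G v2 - sy m (B v2) = sy y1 a + sy y2 b"
      using m S_span w.span_pairE by blast
    obtain t where t: "(x1 + t) * (y2 + t) \<noteq> x2 * y1" using quad by blast
    \<comment> \<open>The determinant of the corrected values \<open>P\<close>, \<open>Q\<close> at
      \<open>p t\<close> in the basis \<open>a\<close>, \<open>b\<close> of \<open>S\<close>. When
      it is nonzero, Cramer's rule recovers \<open>a\<close> and \<open>b\<close> from
      \<open>P\<close> and \<open>Q\<close>.\<close>
    define D where "D = (x1 + t) * (y2 + t) - x2 * y1"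
    have "D \<noteq> 0" using t by (simp add: D_def)
    define P Q where "P = F (p t) - sy l (B (p t))" and "Q = G (p t) - sy m (B (p t))"
    have PQ: "P \<in> img {p t}" "Q \<in> img {p t}"
      by (simp_all add: P_def Q_def in_img w.subspace_diff w.subspace_scale)
    have P: "P = sy (x1 + t) a + sy x2 b"
    proof -
      have "P = (F v2 - sy l (B v2)) + sy t a" by (simp add: P_def F B a_def)
      then show ?thesis by (simp add: x w.scale_left_distrib)
    qed
    have Q: "Q = sy y1 a + sy (y2 + t) b"
    proof -
      have "Q = (G v2 - sy m (B v2)) + sy t b" by (simp add: Q_def G B b_def)
      then show ?thesis by (simp add: y w.scale_left_distrib)
    qed
    have "sy D a = sy (y2 + t) P - sy x2 Q"
      by (simp add: D_def P Q w.scale_right_distrib w.scale_left_distrib w.scale_left_diff_distrib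
        algebra_simps)
    then have "sy D a \<in> img {p t}" using PQ by (simp add: w.subspace_diff w.subspace_scale)
    then have "a \<in> img {p t}"
      using w.subspace_scale_iff[OF subspace_img \<open>D \<noteq> 0\<close>] by blast
    moreover have "sy D b = sy (x1 + t) Q - sy y1 P"
      by (simp add: D_def P Q w.scale_right_distrib w.scale_left_distrib w.scale_left_diff_distrib
        algebra_simps)
    then have "sy D b \<in> img {p t}" using PQ by (simp add: w.subspace_diff w.subspace_scale)
    then have "b \<in> img {p t}"
      using w.subspace_scale_iff[OF subspace_img \<open>D \<noteq> 0\<close>] by blast
    ultimately show False using notpair ab abS by blast
  qed
  show ?thesis
  proof (cases "B v2 = 0")
    case False
    \<comment> \<open>Every \<open>img {p t}\<close> meets \<open>S\<close> in the same line, that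
      of \<open>B v2\<close>, so any vector of \<open>S\<close> off this line works.\<close>
    have "S \<noteq> w.span {B v2}" using S(3) w.dim_singleton_fin[of "B v2"] by (auto split: if_splits)
    then obtain y where y: "y \<in> S" "y \<notin> w.span {B v2}"
      using BS w.span_minimal[of "{B v2}" S] S(1) by auto
    have "y \<notin> img {p t}" for t
      using notpair[OF y(1) BS False y(2)] in_img(3)[of "p t"] B by auto
    moreover have "y \<noteq> 0" using y w.span_zero by auto
    ultimately show ?thesis using finish y by blast
  next
    case B0: True
    \<comment> \<open>Here \<open>B\<close> vanishes on all of \<open>V\<close>, so two maps
      \<open>f\<close>, \<open>g\<close> remain. As \<open>g v2\<close> lies outside
      \<open>S\<close>, some combination \<open>h = f - k g\<close> takes both \<open>v1\<close> and
      \<open>v2\<close> into \<open>S\<close>; the required vector is \<open>h v1\<close>.\<close>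
    have swap: "peelable V W"
      if f: "lin f" "lin g" "\<And>x. img {x} = w.span {f x, g x, B x}" "g v2 \<notin> S" "f v1 \<notin> w.span {g v1}"
      for f g
    proof -
      have fg: "f x \<in> img {x}" "g x \<in> img {x}" for x using f(3) w.span_base by auto
      then have "g v2 \<in> W" "f v2 \<in> W" using img_subset[of "{v2}"] v2 by auto
      then obtain k where k: "f v2 - sy k (g v2) \<in> S"
        using W_eq[of "g v2"] f(4) w.span_breakdown_eq[of "f v2" "g v2" S] S(1) by auto
      define h where "h x = f x - sy k (g x)" for x
      have h: "h (p t) = h v2 + sy t (h v1)" for t
        using f(1,2) by (simp add: h_def p_def lin_def algebra_simps w.scale_right_diff_distrib)
      have himg: "h x \<in> img {x}" for x
        by (simp add: h_def fg w.subspace_diff w.subspace_scale)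
      have h1: "h v1 \<noteq> 0" "h v1 \<in> S"
        using f(5) himg[of v1] by (auto simp: h_def S_def w.span_base w.span_scale)
      have h2: "h v2 \<in> S" using k by (simp add: h_def)
      \<comment> \<open>Otherwise \<open>h\<close> vanishes at some \<open>p (- c)\<close>, where
        \<open>f\<close> and \<open>g\<close> become proportional and the rank drops to at most
        1.\<close>
      have "h v2 \<notin> w.span {h v1}"
      proof
        assume "h v2 \<in> w.span {h v1}"
        then obtain c where c: "h v2 = sy c (h v1)" using w.span_singleton by auto
        then have "h (p (- c)) = 0" by (simp add: h)
        then have "f (p (- c)) = sy k (g (p (- c)))" by (simp add: h_def)
        moreover have "B (p (- c)) = 0" using B B0 by simp
        ultimately have "img {p (- c)} \<subseteq> w.span {g (p (- c))}"
          unfolding f(3) by (intro w.span_minimal) (auto simp: w.span_base w.span_scale w.span_zero)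
        then have "w.dim (img {p (- c)}) \<le> w.dim {g (p (- c))}"
          by (intro w.dim_mono_fin w.fin_spanned_finite) auto
        then show False
          using rk[OF p(1,3)] w.dim_singleton_fin[of "g (p (- c))"] by (simp split: if_splits)
      qed
      \<comment> \<open>If \<open>h v1\<close> were in \<open>img {p t}\<close>, so would be
        \<open>h v2 = h (p t) - t h v1\<close>, and hence the whole plane \<open>S\<close>.\<close>
      then have "h v1 \<notin> img {p t}" for t
        using notpair[OF h2 h1(2,1)] himg[of "p t"] h[of t]
          w.subspace_diff[of "img {p t}" "h (p t)" "sy t (h v1)"] w.subspace_scale[of "img {p t}" "h v1" t]
        by auto
      then show ?thesis using finish h1 by blast
    qed
    have "\<not> (F v2 \<in> S \<and> G v2 \<in> S)"
    proof
      assume "F v2 \<in> S \<and> G v2 \<in> S"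
      then have "img {v2} \<subseteq> S"
        using FGB(4)[of v2] B0 S(1) w.span_minimal[of "{F v2, G v2, B v2}" S] w.subspace_0 by auto
      then show False
        using rank_pair(2)[OF dV v1(1) v2(1) v1(2) v2(2)] S by (simp add: S_def Un_absorb2)
    qed
    then show ?thesis
      using swap[of F G] swap[of G F] FGB ab by (auto simp: a_def b_def insert_commute)
  qed
qed

subsection \<open>Dimensions (3,3)\<close>

text \<open>Sending \<open>u\<close> to the triple of its arrow values turns \<open>P\<close> into a
  plane of rank-one matrices, and such a space has a common image or a common kernel. Hypothesis
  \<open>pair\<close> is the failure of all hyperplanes with image \<open>W\<close>.\<close>

lemma no_rank_1_plane:
  assumes dV: "v.dim V = 3" and dW: "w.dim W = 3"
    and P: "v.subspace P" "P \<subseteq> V" "v.dim P = 2"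
    and rank_P: "\<And>u. u \<in> P \<Longrightarrow> u \<noteq> 0 \<Longrightarrow> w.dim (img {u}) = 1"
    and rank_out: "\<And>u. u \<in> V \<Longrightarrow> u \<notin> P \<Longrightarrow> 2 \<le> w.dim (img {u})"
    and pair: "\<And>H. v.subspace H \<Longrightarrow> H \<subseteq> V \<Longrightarrow> v.dim H = 2 \<Longrightarrow> img H = W \<Longrightarrow>
      \<exists>u\<in>H. \<exists>u'\<in>H. u \<noteq> 0 \<and> u' \<noteq> 0 \<and> img {u} \<inter> img {u'} \<subseteq> {0}"
  shows False
proof -
  have fP: "v.fin_spanned P" using P fin_spanned_V_subset by blast
  have "P \<noteq> V" using P dV by auto
  then obtain v0 where v0: "v0 \<in> V" "v0 \<notin> P" using P by blast
  have V_eq: "v.span (insert x P) = V" if "x \<in> V" "x \<notin> P" for x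
    using v.subspace_eq_fin[of V "v.span (insert x P)"] V P that dV v.dim_insert_fin[OF fP, of x]
      v.span_minimal[of "insert x P" V] by simp
  have "\<not> P \<subseteq> {0}" using P(3) v.dim_eq_0_fin[OF fP] by simp
  then obtain p where p: "p \<in> P" "p \<noteq> 0" by blast
  have pick: "\<exists>q\<in>P. q \<notin> v.span {u}" for u
  proof (rule ccontr)
    assume "\<not> ?thesis"
    then have "v.dim P \<le> v.dim {u}" by (intro v.dim_mono_fin v.fin_spanned_finite) auto
    then show False using P v.dim_single_le_1[of u] by simp
  qed
  obtain q where q: "q \<in> P" "q \<notin> v.span {p}" using pick by blast
  have q0: "q \<noteq> 0" using q v.span_zero by auto
  have P_eq: "v.span {q, p} = P" using v.span_pair_eq_fin[OF P(3) fP P(1) q(1) p q(2)] .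
  have P_E: "\<exists>s t. x = sx s q + sx t p" if "x \<in> P" for x
    using that P_eq v.span_pairE by metis
  obtain wp where wp: "wp \<noteq> 0" "img {p} = w.span {wp}"
    using rank_P[OF p] w.dim_1E subspace_img by metis
  obtain wq where wq: "wq \<noteq> 0" "img {q} = w.span {wq}"
    using rank_P[OF q(1) q0] w.dim_1E subspace_img by metis
  have img_P: "img P = w.span {wq, wp}"
  proof -
    have "img P = img {q, p}" using P_eq img_span by metis
    also have "\<dots> = w.span (img {q} \<union> img {p})" by (rule img_pair)
    also have "\<dots> = w.span {wq, wp}"
      using w.span_pair_Un[of wq wp] wp wq by simp
    finally show ?thesis .
  qed
  show False
  proof (cases "wq \<in> w.span {wp}")
    case True
    then have iP: "img P = w.span {wp}" using img_P w.span_redundant by simp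
    \<comment> \<open>Common image. As \<open>img P\<close> is a line, the rank inequality gives
      every vector outside \<open>P\<close> the full image \<open>W\<close>. So \<open>wp\<close>
      lies in the image of every nonzero vector, and the plane through \<open>v0\<close> and
      \<open>p\<close> contradicts \<open>pair\<close>.\<close>
    have out: "img {x} = W" if "x \<in> V" "x \<notin> P" for x
    proof -
      have "w.dim W < w.dim (img P) + w.dim (img (v.span {x}))"
      proof (rule rank_sum_gt)
        show "v.span (P \<union> v.span {x}) = V"
          using V_eq[OF that] v.span_Un_span[of P "{x}"] P(1) by simp
        show "P \<inter> v.span {x} = {0}" using v.span_Int_single[OF P(1) that(2)] by blast
        show "P \<noteq> {0}" using p by blast
        show "v.span {x} \<noteq> {0}" using that P(1) v.subspace_0 v.span_base[of x "{x}"] by auto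
      qed (use P in auto)
      then have "w.dim W \<le> w.dim (img {x})" using iP w.dim_single_le_1[of wp] by simp
      then show ?thesis using w.subspace_eq_fin[of W "img {x}"] W img_subset[of "{x}"] that by simp
    qed
    have wp_in: "wp \<in> img {x}" if "x \<in> V" "x \<noteq> 0" for x
    proof (cases "x \<in> P")
      case True
      then have "img {x} \<subseteq> w.span {wp}" using iP img_mono[of "{x}" P] by simp
      then have "img {x} = w.span {wp}"
        using w.subspace_eq_fin[of "w.span {wp}" "img {x}"] rank_P[OF True that(2)]
          w.dim_single_le_1[of wp] by (simp add: w.fin_spanned_finite)
      then show ?thesis by (simp add: w.span_base)
    next
      case False
      then show ?thesis using out that wp img_subset[of "{p}"] p P w.span_base[of wp "{wp}"] by auto
    qed
    have "v0 \<notin> v.span {p}" using v0 p P v.span_minimal[of "{p}" P] by auto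
    then have d: "v.dim {v0, p} = 2"
      using v.dim_insert_fin[of "{p}" v0] v.dim_singleton_fin[of p] p by (simp add: v.fin_spanned_finite)
    have s: "v.span {v0, p} \<subseteq> V" using v0 p P V v.span_minimal[of "{v0, p}" V] by auto
    have "img (v.span {v0, p}) = W"
      using out[OF v0] img_subset[OF s] img_mono[of "{v0}" "{v0, p}"] by auto
    then obtain u u' where "u \<in> V" "u' \<in> V" "u \<noteq> 0" "u' \<noteq> 0" "img {u} \<inter> img {u'} \<subseteq> {0}"
      using pair[of "v.span {v0, p}"] d s by auto
    then show False using wp_in[of u] wp_in[of u'] wp by blast
  next
    case False
    \<comment> \<open>Common kernel. Since \<open>q + p\<close> also has rank 1, its arrow values
      are multiples \<open>c g\<close> of one vector \<open>z\<close>; comparing coefficients over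
      the independent \<open>wq\<close>, \<open>wp\<close> shows that the same factors
      \<open>c g\<close> govern the arrows at \<open>q\<close> and at \<open>p\<close>.\<close>
    obtain g0 d where gd: "\<And>x g. x \<in> P \<Longrightarrow> A g x = sy (d g) (A g0 x)"
    proof -
      have qp: "q + p \<in> P" "q + p \<noteq> 0"
      proof -
        show "q + p \<in> P" using p q P v.subspace_add by blast
        have "q + p \<notin> v.span {p}" using q v.span_add_eq2[of p "{p}" q] v.span_base by simp
        then show "q + p \<noteq> 0" using v.span_zero by auto
      qed
      obtain z where z: "z \<noteq> 0" "img {q + p} = w.span {z}"
        using rank_P[OF qp] w.dim_1E subspace_img by metis
      have "z \<in> img P" using z img_mono[of "{q + p}" P] qp w.span_base[of z "{z}"] by auto
      then obtain y x where yx: "z = sy y wq + sy x wp" using img_P w.span_pairE by metis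
      have "\<exists>c. A g (q + p) = sy c z" for g
        using A_in_img[of "q + p" "{q + p}" g] z w.span_singleton by auto
      then obtain c where c: "\<And>g. A g (q + p) = sy (c g) z" by metis
      have Aqp: "A g q = sy (c g * y) wq \<and> A g p = sy (c g * x) wp" for g
      proof -
        obtain a b where a: "A g q = sy a wq" and b: "A g p = sy b wp"
          using A_in_img[of q "{q}" g] A_in_img[of p "{p}" g] wp wq w.span_singleton by auto
        have "sy a wq + sy b wp = sy (c g) (sy y wq + sy x wp)"
          using c[of g] a b yx by (simp add: A_add)
        then have eq: "sy (a - c g * y) wq = sy (c g * x - b) wp"
          by (simp add: w.scale_right_distrib w.scale_left_diff_distrib algebra_simps)
        have "a - c g * y = 0"
        proof (rule ccontr)
          assume nz: "a - c g * y \<noteq> 0"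
          have "sy (a - c g * y) wq \<in> w.span {wp}"
            unfolding eq by (simp add: w.span_base w.span_scale)
          then show False using w.subspace_scale_iff[OF w.subspace_span nz] False by blast
        qed
        moreover from this have "c g * x - b = 0" using eq wp by simp
        ultimately show ?thesis using a b by simp
      qed
      have "\<exists>g. c g \<noteq> 0"
      proof (rule ccontr)
        assume "\<not> ?thesis"
        then have "A g p = 0" for g using Aqp[of g] by simp
        then have "img {p} = {0}" by (simp add: img_single)
        then show False using rank_P[OF p] by simp
      qed
      then obtain g0 where g0: "c g0 \<noteq> 0" by blast
      have "A g u = sy (c g / c g0) (A g0 u)" if "u \<in> P" for u g
      proof -
        obtain s t where "u = sx s q + sx t p" using P_E[OF \<open>u \<in> P\<close>] by blast
        then show ?thesis using Aqp g0
          by (simp add: A_add A_scale w.scale_right_distrib mult_ac)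
      qed
      then show ?thesis by (rule that)
    qed
    define T where "T = A g0"
    \<comment> \<open>These corrections vanish on \<open>P\<close>, so they are constant on the
      coset \<open>v0 + P\<close>. Hence the image of a vector of that coset is \<open>K\<close>
      together with one further value of \<open>T\<close>.\<close>
    define B where "B g x = A g x - sy (d g) (T x)" for g x
    define K where "K = w.span (range (\<lambda>g. B g v0))"
    have T_lin: "T (x + y) = T x + T y" "T (sx c x) = sy c (T x)" "T (x - y) = T x - T y" for x y c
      by (simp_all add: T_def A_add A_scale A_diff)
    have T_in: "T x \<in> img S" if "x \<in> S" for x S using A_in_img[OF that] by (simp add: T_def)
    have AP: "A g x = sy (d g) (T x)" if "x \<in> P" for g x unfolding T_def by (rule gd[OF that])
    have img_x: "img {x} = w.span {T x}" if "x \<in> P" for x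
    proof
      show "img {x} \<subseteq> w.span {T x}"
        using AP[OF that] by (intro img_least) (auto simp: w.span_base w.span_scale)
      show "w.span {T x} \<subseteq> img {x}" using T_in[of x "{x}"] by (intro w.span_minimal) auto
    qed
    have T_nz: "T x \<noteq> 0" if "x \<in> P" "x \<noteq> 0" for x
      using img_x[OF that(1)] rank_P[OF that] by auto
    have TP: "\<exists>x\<in>P. z = T x" if "z \<in> img P" for z
    proof -
      have "z \<in> w.span {T q, T p}"
        using that P_eq img_pair[of q p] img_x[OF q(1)] img_x[OF p(1)] img_span[of "{q, p}"]
          w.span_pair_Un[of "T q" "T p"]
        by simp
      then obtain s t where "z = sy s (T q) + sy t (T p)" using w.span_pairE by blast
      then have "z = T (sx s q + sx t p)" by (simp add: T_lin)
      moreover have "sx s q + sx t p \<in> P" using p q P by (simp add: v.subspace_add v.subspace_scale)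
      ultimately show ?thesis by blast
    qed
    have B_eq: "B g (v0 + x) = B g v0" if "x \<in> P" for g x
      using AP[OF that] by (simp add: B_def A_add T_lin w.scale_right_distrib)
    have img_v: "img {v0 + x} = w.span (insert (T (v0 + x)) K)" if "x \<in> P" for x
    proof
      show "img {v0 + x} \<subseteq> w.span (insert (T (v0 + x)) K)"
      proof (rule img_least)
        fix g y assume "y \<in> {v0 + x}"
        then have "A g y = B g v0 + sy (d g) (T (v0 + x))"
          using B_eq[OF that, of g] by (simp add: B_def diff_eq_eq)
        moreover have "B g v0 \<in> w.span (insert (T (v0 + x)) K)"
          by (auto simp: K_def intro!: w.span_base)
        ultimately show "A g y \<in> w.span (insert (T (v0 + x)) K)"
          by (simp add: w.span_add w.span_scale w.span_base)
      qed simp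
      have "B g (v0 + x) \<in> img {v0 + x}" for g
        unfolding B_def by (simp add: w.subspace_diff w.subspace_scale A_in_img T_in)
      then have "B g v0 \<in> img {v0 + x}" for g
        using B_eq[OF that] by metis
      then have "K \<subseteq> img {v0 + x}" unfolding K_def by (intro w.span_minimal) auto
      then show "w.span (insert (T (v0 + x)) K) \<subseteq> img {v0 + x}"
        by (intro w.span_minimal) (auto simp: T_in)
    qed
    have vx: "v0 + x \<in> V" "v0 + x \<notin> P" if "x \<in> P" for x
      using that v0 P V v.add_notin[of P x v0] by (auto simp: v.subspace_add)
    have sK: "w.subspace K" by (simp add: K_def)
    have K_img: "K \<subseteq> img {v0 + x}" if "x \<in> P" for x
      using img_v[OF that] w.span_superset[of "insert (T (v0 + x)) K"] by auto
    have KW: "K \<subseteq> W" using K_img[of 0] img_subset[of "{v0}"] v0 P v.subspace_0 by auto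
    have fK: "w.fin_spanned K" using KW fin_spanned_W_subset by blast
    \<comment> \<open>If \<open>T u \<in> K\<close>, then \<open>T u\<close> lies in the image of every nonzero vector of \<open>v.span {v0 + x, u}\<close>.\<close>
    show False
    proof (cases "\<exists>u\<in>P. u \<noteq> 0 \<and> T u \<in> K")
      case True
      then obtain u where u: "u \<in> P" "u \<noteq> 0" "T u \<in> K" by blast
      have u_E: "\<exists>a b. h = sx a y + sx b u" if "h \<in> v.span {y, u}" for h y
        using that v.span_pairE by metis
      have ne: "img {v0 + x} \<noteq> W" if x: "x \<in> P" for x
      proof
        assume "img {v0 + x} = W"
        have nu: "v0 + x \<notin> v.span {u}" using vx[OF x] u P v.span_minimal[of "{u}" P] by auto
        then have d: "v.dim {v0 + x, u} = 2"
          using v.dim_insert_fin[of "{u}" "v0 + x"] v.dim_singleton_fin[of u] u by (simp add: v.fin_spanned_finite)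
        have s: "v.span {v0 + x, u} \<subseteq> V" using vx[OF x] u P V v.span_minimal[of "{v0 + x, u}" V] by auto
        have Tu: "T u \<in> img {h}" if h: "h \<in> v.span {v0 + x, u}" "h \<noteq> 0" for h
        proof -
          obtain a b where ab: "h = sx a (v0 + x) + sx b u" using u_E[OF h(1)] by blast
          show ?thesis
          proof (cases "a = 0")
            case True
            then have "h \<in> v.span {u}" using ab by (simp add: v.span_base v.span_scale)
            then show ?thesis using img_proportional[OF h(2)] T_in[of u "{u}"] by simp
          next
            case False
            define x' where "x' = x + sx (b / a) u"
            have x': "x' \<in> P" using x u P by (simp add: x'_def v.subspace_add v.subspace_scale)
            have "h = sx a (v0 + x')"
              using False by (simp add: ab x'_def v.scale_right_distrib add.assoc)
            then have "h \<in> v.span {v0 + x'}" by (simp add: v.span_base v.span_scale)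
            then show ?thesis using img_proportional[OF h(2)] K_img[OF x'] u by auto
          qed
        qed
        have "img (v.span {v0 + x, u}) = W"
          using \<open>img {v0 + x} = W\<close> img_subset[OF s] img_mono[of "{v0 + x}" "{v0 + x, u}"] by auto
        then obtain h h' where "h \<in> v.span {v0 + x, u}" "h' \<in> v.span {v0 + x, u}" "h \<noteq> 0" "h' \<noteq> 0"
          "img {h} \<inter> img {h'} \<subseteq> {0}"
          using pair[of "v.span {v0 + x, u}"] d s by auto
        then show False using Tu[of h] Tu[of h'] T_nz[OF u(1,2)] by blast
      qed
      show False
      proof (cases "2 \<le> w.dim K")
        case True
        \<comment> \<open>The images of \<open>v0 + x\<close> contain \<open>K\<close> and differ
          from the three-dimensional \<open>W\<close>, so all of them equal \<open>K\<close>.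
          Differences then put \<open>img V\<close> into \<open>K\<close>, against
          \<open>img_V\<close>.\<close>
        have TK: "T (v0 + x) \<in> K" if x: "x \<in> P" for x
        proof (rule ccontr)
          assume "T (v0 + x) \<notin> K"
          then have "3 \<le> w.dim (img {v0 + x})"
            using img_v[OF x] w.dim_insert_fin[OF fK, of "T (v0 + x)"] sK True by simp
          then show False
            using ne[OF x] w.subspace_eq_fin[of W "img {v0 + x}"] W dW img_subset[of "{v0 + x}"] vx[OF x]
            by simp
        qed
        have K0: "img {v0 + x} = K" if "x \<in> P" for x
          using img_v[OF that] TK[OF that] sK by (simp add: insert_absorb)
        have "A g x \<in> K" if "x \<in> insert v0 P" for x g
        proof (cases "x = v0")
          case True
          then show ?thesis using K0[of 0] A_in_img[of v0 "{v0}" g] P v.subspace_0 by auto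
        next
          case False
          then have "x \<in> P" using that by simp
          then have "A g (v0 + x) - A g (v0 + 0) \<in> K"
            using K0[of x] K0[of 0] A_in_img[of "v0 + x" "{v0 + x}" g] A_in_img[of "v0 + 0" "{v0 + 0}" g]
              w.subspace_diff[OF sK] P v.subspace_0 by simp
          then show ?thesis by (simp add: A_add)
        qed
        then have "img (insert v0 P) \<subseteq> K" by (intro img_least sK)
        then have "W \<subseteq> K" using V_eq[OF v0] img_V img_span by metis
        then show False using K0[of 0] ne[of 0] KW P v.subspace_0 by auto
      next
        case False
        have "w.span {T u} = K"
          using w.subspace_eq_fin[OF fK, of "w.span {T u}"] sK u False T_nz[OF u(1,2)]
            w.dim_singleton_fin[of "T u"] w.span_minimal[of "{T u}" K] by simp
        \<comment> \<open>With \<open>K\<close> the line of \<open>T u\<close>, the plane of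
          \<open>v0\<close>, \<open>u\<close> has an image of dimension at most 2. A vector
          \<open>x\<close> of \<open>P\<close> off the line of \<open>u\<close> complements it with
          rank 1, and 2 + 1 does not exceed \<open>dim W\<close>.\<close>
        then have i: "img {v0, u} \<subseteq> w.span {T v0, T u}"
        proof -
          have "img {u} \<subseteq> w.span {T v0, T u}" using img_x[OF u(1)] by (simp add: w.span_mono)
          moreover have "img {v0} = w.span {T v0, T u}"
            using img_v[of 0] \<open>w.span {T u} = K\<close> P v.subspace_0 w.span_insert[of "T v0" "{T u}"]
              w.span_insert[of "T v0" K] sK by auto
          ultimately show ?thesis
            using img_pair[of v0 u] w.span_minimal[of "img {v0} \<union> img {u}" "w.span {T v0, T u}"]
            by simp
        qed
        have "card {T v0, T u} \<le> 2" by (simp add: card_insert_if)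
        then have i2: "w.dim (img {v0, u}) \<le> 2" using w.dim_le_card[OF i] by simp
        obtain x where x: "x \<in> P" "x \<notin> v.span {u}" using pick by blast
        have x0: "x \<noteq> 0" using x v.span_zero by auto
        have xn: "x \<notin> v.span {v0, u}"
        proof
          assume "x \<in> v.span {v0, u}"
          then obtain a b where ab: "x = sx a v0 + sx b u" using u_E by blast
          then have "sx a v0 = x - sx b u" by simp
          then have "sx a v0 \<in> P" using x u P by (simp add: v.subspace_diff v.subspace_scale)
          then have "a = 0" using v.subspace_scale_iff[OF P(1), of a v0] v0 by auto
          then show False using ab x by (simp add: v.span_base v.span_scale)
        qed
        have "w.dim W < w.dim (img (v.span {x})) + w.dim (img (v.span {v0, u}))"
        proof (rule rank_sum_gt)
          show "v.span {x} \<inter> v.span {v0, u} = {0}" using v.span_Int_single[OF _ xn] by simp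
          show "v.span {x} \<noteq> {0}" using x0 v.span_base[of x "{x}"] by auto
          show "v.span {v0, u} \<noteq> {0}" using u v.span_base[of u "{v0, u}"] by auto
          have "v.span {x, u} = P" using v.span_pair_eq_fin[OF P(3) fP P(1) x(1) u(1,2) x(2)] .
          then have "insert v0 P \<subseteq> v.span {v0, x, u}"
            using v.span_mono[of "{x, u}" "{v0, x, u}"] v.span_base[of v0 "{v0, x, u}"] by auto
          then have "V \<subseteq> v.span {v0, x, u}" using V_eq[OF v0] v.span_minimal by (metis v.subspace_span)
          moreover have "v.span (v.span {x} \<union> v.span {v0, u}) = v.span ({x} \<union> {v0, u})"
            by (rule v.span_Un_span)
          moreover have "v.span {v0, x, u} \<subseteq> V" using v0 x u P V v.span_minimal[of "{v0, x, u}" V] by auto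
          ultimately show "v.span (v.span {x} \<union> v.span {v0, u}) = V"
            by (simp add: insert_commute)
        qed auto
        then show False using i2 rank_P[OF x(1) x0] dW by simp
      qed
    next
      case no: False
      have fI: "w.fin_spanned (img P)" using img_P by (simp add: w.fin_spanned_finite)
      have int: "img P \<inter> K \<subseteq> {0}"
      proof
        fix z assume "z \<in> img P \<inter> K"
        then obtain x where "x \<in> P" "z = T x" "T x \<in> K" using TP by blast
        then show "z \<in> {0}" using no T_lin(2)[of 0 0] by auto
      qed
      have dI: "w.dim (img P) = 2"
        using img_P w.dim_insert_fin[of "{wp}" wq] w.dim_singleton_fin[of wp] False wp
        by (simp add: w.fin_spanned_finite)
      have d0: "w.dim (img P \<inter> K) = 0"
        using w.dim_eq_0_fin[OF w.fin_spanned_subset[OF fI, of "img P \<inter> K"]] int by blast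
      have "img P \<union> K \<subseteq> w.span W" using img_subset[OF P(2)] KW W by simp
      then have "w.dim (img P \<union> K) \<le> 3" using w.dim_mono_fin[OF W(2)] dW by metis
      then have dK: "w.dim K \<le> 1"
        using w.dim_Un_Int[OF fI fK _ sK] dI d0 by simp
      show False
      proof (cases "w.dim K = 0")
        case True
        then have "w.dim (img {v0 + 0}) \<le> 1"
          using img_v[of 0] w.dim_insert_fin[OF fK, of "T v0"] P v.subspace_0 by simp
        then show False using rank_out[OF v0] by simp
      next
        case F: False
        then have "w.span (img P \<union> K) = W"
          using w.span_Un_eq_fin[OF W(2,1) img_subset[OF P(2)] KW _ sK int] dI dW by simp
        moreover have "T v0 \<in> W" using T_in[of v0 V] v0 img_V by simp
        ultimately obtain y z where yz: "T v0 = y + z" "y \<in> img P" "z \<in> K"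
          using w.span_Un[of "img P" K] sK by auto
        \<comment> \<open>Subtracting this \<open>x\<close> from \<open>v0\<close> moves the value
          of \<open>T\<close> into the line \<open>K\<close>, so \<open>v0 - x\<close> is a vector
          outside \<open>P\<close> of rank at most 1.\<close>
        obtain x where x: "x \<in> P" "y = T x" using TP yz by blast
        have x': "- x \<in> P" using x P v.subspace_neg by blast
        have "T (v0 + - x) \<in> K" using yz x T_lin(3)[of v0 x] by simp
        then have "img {v0 + - x} = K" using img_v[OF x'] sK by (simp add: insert_absorb)
        then show False using rank_out[OF vx[OF x']] dK by simp
      qed
    qed
  qed
qed

text \<open>If no hyperplane works, every plane with image \<open>W\<close> contains a nonzero
  vector of rank at most 1. This forces the low-rank vectors to fill a plane, which
  \<open>no_rank_1_plane\<close> excludes.\<close>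

lemma peelable_3_3:
  assumes dV: "v.dim V = 3" and dW: "w.dim W = 3"
  shows "peelable V W"
proof (rule ccontr)
  assume not: "\<not> peelable V W"
  have pair: "\<exists>u\<in>H. \<exists>u'\<in>H. u \<noteq> 0 \<and> u' \<noteq> 0 \<and> img {u} \<inter> img {u'} \<subseteq> {0}"
    if H: "v.subspace H" "H \<subseteq> V" "v.dim H = 2" "img H = W" for H
  proof -
    have "H \<noteq> V" using H dV by auto
    then obtain x where x: "x \<in> V" "x \<notin> H" using H by blast
    have sp: "v.span (insert x H) = V"
      using v.subspace_eq_fin[of V "v.span (insert x H)"] V H x dV
        v.dim_insert_fin[OF fin_spanned_V_subset[OF H(2)], of x]
        v.span_minimal[of "insert x H" V] by simp
    show ?thesis
    proof (rule ccontr)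
      assume none: "\<not> ?thesis"
      have "peelable V W"
      proof (rule peelable_hyperplaneI[OF H(1) x(2) sp H(4)])
        fix u u' assume "u \<in> H" "u' \<in> H" "u \<noteq> 0" "u' \<notin> v.span {u}"
        moreover from this have "u' \<noteq> 0" using v.span_zero by auto
        ultimately show "\<not> img {u} \<inter> img {u'} \<subseteq> {0}" using none by blast
      qed
      then show False using not by blast
    qed
  qed
  \<comment> \<open>Two images meeting trivially in a three-dimensional space have ranks adding up
    to at most 3.\<close>
  have low: "\<exists>u\<in>H. u \<noteq> 0 \<and> w.dim (img {u}) \<le> 1"
    if H: "v.subspace H" "H \<subseteq> V" "v.dim H = 2" "img H = W" for H
  proof -
    obtain u u' where u: "u \<in> H" "u' \<in> H" "u \<noteq> 0" "u' \<noteq> 0" "img {u} \<inter> img {u'} \<subseteq> {0}"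
      using pair[OF H] by blast
    have "w.dim (img {u} \<inter> img {u'}) = 0"
      using w.dim_eq_0_fin[OF w.fin_spanned_subset[of "img {u}" "img {u} \<inter> img {u'}"]] u by simp
    moreover have "img {u} \<union> img {u'} \<subseteq> w.span W" using u H img_mono[of "{u}" H] img_mono[of "{u'}" H] W by simp
    then have "w.dim (img {u} \<union> img {u'}) \<le> 3" using w.dim_mono_fin[OF W(2)] dW by metis
    ultimately have "w.dim (img {u}) + w.dim (img {u'}) \<le> 3"
      using w.dim_Un_Int[of "img {u}" "img {u'}"] by simp
    then have "w.dim (img {u}) \<le> 1 \<or> w.dim (img {u'}) \<le> 1" by linarith
    then show ?thesis using u by blast
  qed
  define R where "R = {u \<in> V. w.dim (img {u}) \<le> 1}"
  have "R \<subseteq> V" by (auto simp: R_def)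
  \<comment> \<open>Three independent vectors of rank at most 1 would split \<open>V\<close> into a
    line and a plane with images of dimension at most 1 and 2, against the rank inequality.\<close>
  have dR: "v.dim R \<le> 2"
  proof (rule ccontr)
    assume "\<not> ?thesis"
    moreover have "v.dim R \<le> 3" using v.dim_mono_fin[OF V(2), of R] V dV \<open>R \<subseteq> V\<close> by simp
    ultimately have "v.dim R = 3" by simp
    then obtain B where B: "B \<subseteq> R" "v.independent B" "card B = 3"
      using v.basis_exists[of R] by metis
    have BV: "v.span B = V"
      using v.subspace_eq_fin[of V "v.span B"] V v.dim_span_eq_card_independent[OF B(2)] B(1,3) \<open>R \<subseteq> V\<close> dV
        v.span_minimal[of B V] by auto
    obtain b1 b2 b3 where b: "B = {b1, b2, b3}" "b1 \<noteq> b2" "b1 \<noteq> b3" "b2 \<noteq> b3"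
      using B(3) unfolding card_3_iff by blast
    have b1: "b1 \<notin> v.span {b2, b3}" using B(2) b by (simp add: v.independent_insert)
    have nz: "b1 \<noteq> 0" "b2 \<noteq> 0" using B(2) b v.dependent_zero by auto
    have r: "w.dim (img {b1}) \<le> 1" "w.dim (img {b2}) \<le> 1" "w.dim (img {b3}) \<le> 1"
      using B(1) b by (auto simp: R_def)
    have "w.dim W < w.dim (img (v.span {b1})) + w.dim (img (v.span {b2, b3}))"
    proof (rule rank_sum_gt)
      show "v.span {b1} \<inter> v.span {b2, b3} = {0}" using v.span_Int_single[OF _ b1] by simp
      show "v.span (v.span {b1} \<union> v.span {b2, b3}) = V"
        using v.span_Un_span[of "{b1}" "{b2, b3}"] BV b by (simp add: insert_commute)
      show "v.span {b1} \<noteq> {0}" "v.span {b2, b3} \<noteq> {0}"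
        using nz v.span_base[of b1 "{b1}"] v.span_base[of b2 "{b2, b3}"] by auto
    qed auto
    moreover have "w.dim (img {b2, b3}) \<le> 2"
      using img_pair[of b2 b3] w.dim_Un_le[of "img {b2}" "img {b3}"] r by simp
    ultimately show False using r dW by simp
  qed
  \<comment> \<open>A priori \<open>R\<close> may span less than a plane, so any plane containing it
    is taken; \<open>rank_P\<close> shows afterwards that \<open>R\<close> fills it.\<close>
  obtain P where P: "v.subspace P" "v.span R \<subseteq> P" "P \<subseteq> V" "v.dim P = 2"
    using v.intermediate_subspace[of V "v.span R" 2] V dR dV v.span_minimal[OF \<open>R \<subseteq> V\<close>] by auto
  have RP: "R \<subseteq> P" using P v.span_superset by blast
  have rank_out: "2 \<le> w.dim (img {u})" if "u \<in> V" "u \<notin> P" for u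
    using that RP by (auto simp: R_def)
  have "P \<noteq> V" using P dV by auto
  then obtain v0 where v0: "v0 \<in> V" "v0 \<notin> P" using P by blast
  have V_eq: "v.span (insert v0 P) = V"
    using v.subspace_eq_fin[of V "v.span (insert v0 P)"] V P v0 dV
      v.dim_insert_fin[OF fin_spanned_V_subset[OF P(3)], of v0]
      v.span_minimal[of "insert v0 P" V] by simp
  have rank_P: "w.dim (img {u}) = 1" if u: "u \<in> P" "u \<noteq> 0" for u
  proof (rule ccontr)
    assume "w.dim (img {u}) \<noteq> 1"
    then have ru: "2 \<le> w.dim (img {u})" using rank_pos[of u] u P by auto
    \<comment> \<open>The plane spanned by \<open>y\<close> and \<open>u\<close> has no vector of rank 1, so its image is not \<open>W\<close>.\<close>
    have iH: "img {y} \<subseteq> img {u} \<and> img {u} \<noteq> W" if y: "y \<in> V" "y \<notin> P" for y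
    proof -
      have nu: "y \<notin> v.span {u}" using y u P v.span_minimal[of "{u}" P] by auto
      then have d: "v.dim {y, u} = 2"
        using v.dim_insert_fin[of "{u}" y] v.dim_singleton_fin[of u] u by (simp add: v.fin_spanned_finite)
      have s: "v.span {y, u} \<subseteq> V" using y u P V v.span_minimal[of "{y, u}" V] by auto
      have "2 \<le> w.dim (img {h})" if h: "h \<in> v.span {y, u}" "h \<noteq> 0" for h
      proof (cases "h \<in> P")
        case True
        obtain a b where ab: "h = sx a y + sx b u" using h v.span_pairE by blast
        then have "sx a y = h - sx b u" by simp
        then have "sx a y \<in> P" using True u P by (simp add: v.subspace_diff v.subspace_scale)
        then have "a = 0" using v.subspace_scale_iff[OF P(1), of a y] y by auto
        then have "h \<in> v.span {u}" using ab by (simp add: v.span_base v.span_scale)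
        then show ?thesis using img_proportional h ru by metis
      next
        case False
        then show ?thesis using rank_out h s by blast
      qed
      then have nW: "img {y, u} \<noteq> W" using low[of "v.span {y, u}"] d s by fastforce
      have yu: "img {y, u} \<subseteq> W" using img_subset[OF s] by simp
      then have "w.dim (img {y, u}) \<noteq> 3"
        using nW w.subspace_eq_fin[OF W(2), of "img {y, u}"] dW by auto
      moreover have "w.dim (img {y, u}) \<le> 3" using w.dim_mono_fin[OF W(2), of "img {y, u}"] yu W dW by simp
      ultimately have "w.dim (img {y, u}) \<le> w.dim (img {u})" using ru by linarith
      then have "img {u} = img {y, u}"
        using w.subspace_eq_fin[of "img {y, u}" "img {u}"] img_mono[of "{u}" "{y, u}"]
          fin_spanned_W_subset[OF yu] by simp
      then show ?thesis using nW img_mono[of "{y}" "{y, u}"] by auto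
    qed
    \<comment> \<open>A vector \<open>x\<close> of \<open>P\<close> is the difference of
      \<open>v0 + x\<close> and \<open>v0\<close>, both outside \<open>P\<close>, where
      \<open>iH\<close> applies. So \<open>img V\<close> would lie in \<open>img {u}\<close>, which
      is not \<open>W\<close>.\<close>
    have "A g x \<in> img {u}" if "x \<in> insert v0 P" for x g
    proof (cases "x = v0")
      case True
      then show ?thesis using iH[OF v0] A_in_img[of v0 "{v0}" g] by auto
    next
      case False
      then have "x \<in> P" using that by simp
      then have "v0 + x \<in> V" "v0 + x \<notin> P" using v0 P V v.add_notin[of P x v0] by (auto simp: v.subspace_add)
      then have "A g (v0 + x) \<in> img {u}" using iH[of "v0 + x"] A_in_img[of "v0 + x" "{v0 + x}" g] by auto
      moreover have "A g v0 \<in> img {u}" using iH[OF v0] A_in_img[of v0 "{v0}" g] by auto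
      ultimately have "A g (v0 + x) - A g v0 \<in> img {u}" by (simp add: w.subspace_diff)
      then show ?thesis by (simp add: A_add)
    qed
    then have "img (insert v0 P) \<subseteq> img {u}" by (intro img_least) auto
    then have "W \<subseteq> img {u}" using V_eq img_V img_span by metis
    then show False using iH[OF v0] img_subset[of "{u}"] u P by auto
  qed
  show False using no_rank_1_plane[OF dV dW P(1,3,4) rank_P rank_out pair] .
qed

end

section \<open>Duality\<close>

locale fin_basis = fin_space scale
  for scale :: "'k::field \<Rightarrow> 'b::ab_group_add \<Rightarrow> 'b" +
  fixes B :: "'b set"
  assumes finite_B: "finite B" and independent_B: "independent B"
begin

text \<open>Extending \<open>B\<close> to a basis of the whole type makes coordinates linear
  everywhere; on \<open>span B\<close> they agree with the coordinates over
  \<open>B\<close>.\<close>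

definition coord :: "'b \<Rightarrow> 'b \<Rightarrow> 'k" where
  "coord x = representation (extend_basis B) x"

text \<open>The standard bilinear form of the basis identifies \<open>span B\<close> with its dual,
  so transposed arrows live on the same types. It may have isotropic vectors, and
  \<open>perp S\<close> may meet \<open>S\<close>; what counts is nondegeneracy on
  \<open>span B\<close>.\<close>

definition dot :: "'b \<Rightarrow> 'b \<Rightarrow> 'k" where
  "dot x y = (\<Sum>b\<in>B. coord x b * coord y b)"

definition perp :: "'b set \<Rightarrow> 'b set" where
  "perp S = {x \<in> span B. \<forall>s\<in>S. dot x s = 0}"

lemma coord_add: "coord (x + y) b = coord x b + coord y b"
  and coord_scale: "coord (scale c x) b = c * coord x b"
  using representation_add[OF independent_extend_basis[OF independent_B]]
    representation_scale[OF independent_extend_basis[OF independent_B]]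
    span_extend_basis[OF independent_B]
  by (simp_all add: coord_def)

lemma dot_commute: "dot x y = dot y x"
  by (simp add: dot_def mult.commute)

lemma dot_add_left: "dot (x + y) z = dot x z + dot y z"
  and dot_scale_left: "dot (scale c x) z = c * dot x z"
  by (simp_all add: dot_def coord_add coord_scale distrib_right sum.distrib sum_distrib_left mult.assoc)

lemma dot_add_right: "dot z (x + y) = dot z x + dot z y"
  and dot_scale_right: "dot z (scale c x) = c * dot z x"
  by (simp_all only: dot_commute[of z] dot_add_left dot_scale_left)

lemma dot_zero [simp]: "dot 0 z = 0" "dot z 0 = 0"
  using dot_scale_left[of 0 0 z] dot_scale_right[of z 0 0] by simp_all

lemma dot_diff_left: "dot (x - y) z = dot x z - dot y z"
  using dot_add_left[of "x - y" y z] by simp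

lemma dot_sum_left: "dot (\<Sum>i\<in>I. f i) z = (\<Sum>i\<in>I. dot (f i) z)"
  by (induction I rule: infinite_finite_induct) (auto simp: dot_add_left)

lemma dot_basis: "b \<in> B \<Longrightarrow> dot x b = coord x b"
proof -
  assume b: "b \<in> B"
  then have "coord b = (\<lambda>c. if c = b then 1 else 0)"
    using representation_basis[OF independent_extend_basis[OF independent_B]]
      extend_basis_superset[OF independent_B]
    by (auto simp: coord_def)
  then have "dot x b = (\<Sum>c\<in>B. if c = b then coord x c else 0)"
    by (simp add: dot_def if_distrib cong: if_cong)
  then show ?thesis using b finite_B by simp
qed

lemma span_expand:
  assumes "x \<in> span B"
  shows "(\<Sum>b\<in>B. scale (dot x b) b) = x"
proof -
  have "coord x = representation B x"
    using representation_extend[OF independent_extend_basis[OF independent_B] assms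
        extend_basis_superset[OF independent_B]]
    by (simp add: coord_def)
  then show ?thesis
    using sum_representation_eq[OF independent_B assms finite_B order_refl] dot_basis by simp
qed

lemma subspace_perp [simp]: "subspace (perp S)"
  by (rule subspaceI) (auto simp: perp_def span_zero span_add span_scale dot_add_left dot_scale_left)

lemma perp_subset: "perp S \<subseteq> span B"
  by (auto simp: perp_def)

lemma perp_mono: "S \<subseteq> T \<Longrightarrow> perp T \<subseteq> perp S"
  by (auto simp: perp_def)

lemma perp_span: "perp (span S) = perp S"
proof
  show "perp (span S) \<subseteq> perp S" by (rule perp_mono[OF span_superset])
  have "dot x s = 0" if x: "x \<in> perp S" and s: "s \<in> span S" for x s
    using s
  proof (induction rule: span_induct_alt)
    case base
    then show ?case by simp
  next
    case (step c y z)
    then show ?case using x by (simp add: perp_def dot_add_right dot_scale_right)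
  qed
  then show "perp S \<subseteq> perp (span S)" by (auto simp: perp_def)
qed

text \<open>The coordinate at \<open>x\<close> over a basis containing \<open>x\<close> and a basis
  of \<open>S\<close> is a functional \<open>f\<close> that vanishes on \<open>S\<close> and is 1 at
  \<open>x\<close>. On \<open>span B\<close> it is represented by the vector \<open>y\<close> with
  coordinates \<open>f b\<close>.\<close>

lemma perp_separates:
  assumes S: "subspace S" "S \<subseteq> span B" and x: "x \<in> span B" "x \<notin> S"
  obtains y where "y \<in> perp S" "dot y x \<noteq> 0"
proof -
  obtain C where C: "C \<subseteq> S" "independent C" "S \<subseteq> span C"
    using maximal_independent_subset by blast
  then have SC: "S = span C" using S span_minimal by blast
  have iC: "independent (insert x C)" using C SC x by (simp add: independent_insertI)
  define E where "E = extend_basis (insert x C)"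
  have E: "independent E" "span E = UNIV" "insert x C \<subseteq> E"
    using independent_extend_basis[OF iC] span_extend_basis[OF iC] extend_basis_superset[OF iC]
    unfolding E_def by blast+
  define f where "f z = representation E z x" for z
  have f_add: "f (y + z) = f y + f z" and f_scale: "f (scale c z) = c * f z" for y z c
    using representation_add[OF E(1)] representation_scale[OF E(1)] E(2) by (simp_all add: f_def)
  have f_S: "f s = 0" if "s \<in> S" for s
  proof -
    have "representation E s = representation C s"
      using representation_extend[OF E(1), of s C] that SC E(3) by simp
    moreover have "x \<notin> C" using x SC span_base by auto
    ultimately show ?thesis using representation_ne_zero[of C s x] by (auto simp: f_def)
  qed
  have f_x: "f x = 1" using representation_basis[OF E(1), of x] E(3) by (simp add: f_def)
  have f_0: "f 0 = 0" using f_scale[of 0 0] by simp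
  have f_sum: "f (\<Sum>i\<in>I. g i) = (\<Sum>i\<in>I. f (g i))" if "finite I" for g and I :: "'b set"
    using that by (induction I rule: finite_induct) (auto simp: f_add f_0)
  define y where "y = (\<Sum>b\<in>B. scale (f b) b)"
  have dot_y: "dot y z = f z" if "z \<in> span B" for z
  proof -
    have "dot y z = (\<Sum>b\<in>B. f b * dot b z)"
      by (simp add: y_def dot_sum_left dot_scale_left)
    also have "\<dots> = (\<Sum>b\<in>B. f b * dot z b)" by (simp add: dot_commute)
    also have "\<dots> = f (\<Sum>b\<in>B. scale (dot z b) b)"
      by (simp add: f_sum[OF finite_B] f_scale mult.commute)
    finally show ?thesis using span_expand[OF that] by simp
  qed
  have y_in: "y \<in> span B" unfolding y_def by (intro span_sum span_scale span_base)
  have "dot y s = 0" if "s \<in> S" for s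
    using dot_y f_S that S(2) by auto
  then have "y \<in> perp S" using y_in by (simp add: perp_def)
  moreover have "dot y x \<noteq> 0" using dot_y x f_x by simp
  ultimately show ?thesis using that by blast
qed

lemma perp_perp:
  assumes "subspace S" "S \<subseteq> span B"
  shows "perp (perp S) = S"
proof
  show "perp (perp S) \<subseteq> S"
  proof
    fix x assume x: "x \<in> perp (perp S)"
    show "x \<in> S"
    proof (rule ccontr)
      assume "x \<notin> S"
      then obtain y where "y \<in> perp S" "dot y x \<noteq> 0"
        using perp_separates[OF assms, of x] x by (auto simp: perp_def)
      then show False using x dot_commute[of x y] by (auto simp: perp_def)
    qed
  qed
  show "S \<subseteq> perp (perp S)"
    using assms(2) dot_commute by (auto simp: perp_def)
qed

lemma perp_zero: "perp {0} = span B"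
  by (auto simp: perp_def)

lemma perp_full: "perp (span B) = {0}"
  using perp_perp[of "{0}"] perp_zero span_zero by auto

lemma perp_span_Un: "perp (span (S \<union> T)) = perp S \<inter> perp T"
  unfolding perp_span by (auto simp: perp_def)

lemma perp_Int:
  assumes "subspace S" "S \<subseteq> span B" "subspace T" "T \<subseteq> span B"
  shows "perp (S \<inter> T) = span (perp S \<union> perp T)"
proof -
  have "perp (span (perp S \<union> perp T)) = S \<inter> T"
    using perp_span_Un[of "perp S" "perp T"] perp_perp assms by simp
  moreover have "span (perp S \<union> perp T) \<subseteq> span B"
    using perp_subset by (intro span_minimal) auto
  ultimately show ?thesis
    using perp_perp[of "span (perp S \<union> perp T)"] by simp
qed

end

locale adjoint_maps =
  a: arrow_maps sx sy A + a': arrow_maps sy sx A' + bv: fin_basis sx BV + bw: fin_basis sy BW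
  for sx :: "'k::field \<Rightarrow> 'a::ab_group_add \<Rightarrow> 'a"
    and sy :: "'k \<Rightarrow> 'b::ab_group_add \<Rightarrow> 'b"
    and A A' BV BW +
  assumes A_span: "x \<in> a.v.span BV \<Longrightarrow> A \<gamma> x \<in> a.w.span BW"
    and A'_span: "y \<in> a.w.span BW \<Longrightarrow> A' \<gamma> y \<in> a.v.span BV"
    and adjoint: "x \<in> a.v.span BV \<Longrightarrow> y \<in> a.w.span BW \<Longrightarrow> bv.dot (A' \<gamma> y) x = bw.dot y (A \<gamma> x)"
begin

lemma adjoint_swap: "adjoint_maps sy sx A' A BW BV"
proof unfold_locales
  fix x y g assume "x \<in> a.w.span BW" "y \<in> a.v.span BV"
  then show "bw.dot (A g y) x = bv.dot y (A' g x)"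
    using adjoint[of y x g] bv.dot_commute bw.dot_commute by metis
qed (fact A_span A'_span)+

text \<open>The dual of the representation with spaces \<open>H\<close> and \<open>W/L\<close> has
  \<open>perp L\<close>, the dual of \<open>W/L\<close>, at its source, and \<open>V\<close> modulo
  \<open>perp H\<close>, the dual of \<open>H\<close>, at its target. Annihilators exchange sums
  with intersections, and \<open>A'\<close> maps the annihilator of \<open>W1\<close> into that of
  \<open>V1\<close>.\<close>

lemma decomp_adjoint:
  assumes sub: "H \<subseteq> a.v.span BV" and dec: "a.decomp H (a.w.span BW) L"
  shows "a'.decomp (bw.perp L) (a.v.span BV) (bv.perp H)"
proof -
  obtain V1 V2 W1 W2 where d:
    "a.v.subspace V1" "a.v.subspace V2" "a.w.subspace W1" "a.w.subspace W2"
    "a.v.span (V1 \<union> V2) = H" "V1 \<inter> V2 = {0}" "a.w.span (W1 \<union> W2) = a.w.span BW" "W1 \<inter> W2 = L"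
    "\<forall>\<gamma>. A \<gamma> ` V1 \<subseteq> W1 \<and> A \<gamma> ` V2 \<subseteq> W2"
    "\<not> (V1 = {0} \<and> W1 = L)" "\<not> (V2 = {0} \<and> W2 = L)"
    using dec unfolding a.decomp_def by (elim exE conjE)
  have s: "V1 \<subseteq> a.v.span BV" "V2 \<subseteq> a.v.span BV" "W1 \<subseteq> a.w.span BW" "W2 \<subseteq> a.w.span BW"
    using d(5,7) sub a.v.span_superset[of "V1 \<union> V2"] a.w.span_superset[of "W1 \<union> W2"] by auto
  have 0: "0 \<in> V1" "0 \<in> V2" "0 \<in> W1" "0 \<in> W2"
    using d(1-4) a.v.subspace_0 a.w.subspace_0 by auto
  have A'_perp: "A' g y \<in> bv.perp X" if y: "y \<in> bw.perp Y" and XY: "\<forall>g. A g ` X \<subseteq> Y" "X \<subseteq> a.v.span BV" for g y X Y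
  proof -
    have "bv.dot (A' g y) x = 0" if "x \<in> X" for x
    proof -
      have "A g x \<in> Y" "x \<in> a.v.span BV" using that XY by blast+
      then show ?thesis using y adjoint by (auto simp: bw.perp_def)
    qed
    then show ?thesis using y A'_span by (auto simp: bv.perp_def bw.perp_def)
  qed
  show ?thesis
  proof (rule a'.decompI)
    show "a.w.span (bw.perp W1 \<union> bw.perp W2) = bw.perp L"
      using bw.perp_Int[of W1 W2] d s by simp
    show "a.v.span (bv.perp V1 \<union> bv.perp V2) = a.v.span BV"
      using bv.perp_Int[of V1 V2] d s bv.perp_zero by simp
    show "bw.perp W1 \<inter> bw.perp W2 = {0}"
      using bw.perp_span_Un[of W1 W2] d(7) bw.perp_full by simp
    show "bv.perp V1 \<inter> bv.perp V2 = bv.perp H"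
      using bv.perp_span_Un[of V1 V2] d(5) by simp
    show "A' \<gamma> y \<in> bv.perp V1" if "y \<in> bw.perp W1" for \<gamma> y
      by (rule A'_perp[OF that _ s(1)]) (use d(9) in simp)
    show "A' \<gamma> y \<in> bv.perp V2" if "y \<in> bw.perp W2" for \<gamma> y
      by (rule A'_perp[OF that _ s(2)]) (use d(9) in simp)
    have full: "Y = a.w.span BW" if "bw.perp Y = {0}" "a.w.subspace Y" "Y \<subseteq> a.w.span BW" for Y
      using bw.perp_perp[OF that(2,3)] that(1) bw.perp_zero by simp
    have eq: "X = H" if "bv.perp X = bv.perp H" "a.v.subspace X" "X \<subseteq> a.v.span BV" for X
      using bv.perp_perp[OF that(2,3)] bv.perp_perp[of H] that(1) sub d(5) a.v.subspace_span by metis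
    have s': "W2 \<subseteq> a.w.span BW" "W1 \<subseteq> a.w.span BW" "V1 \<subseteq> H" "V2 \<subseteq> H"
      using s d(5) a.v.span_superset[of "V1 \<union> V2"] by auto
    \<comment> \<open>A trivial dual summand means that \<open>W1\<close> and \<open>V1\<close> are
      everything, so it is the other original summand that vanishes: the indices are
      exchanged.\<close>
    show "\<not> (bw.perp W1 = {0} \<and> bv.perp V1 = bv.perp H)"
    proof
      assume p: "bw.perp W1 = {0} \<and> bv.perp V1 = bv.perp H"
      have "W1 = a.w.span BW" by (rule full) (use p d s in simp_all)
      moreover have "V1 = H" by (rule eq) (use p d s in simp_all)
      ultimately have "V2 = {0} \<and> W2 = L" using d(6,8) s' by auto
      then show False using d(11) by blast
    qed
    show "\<not> (bw.perp W2 = {0} \<and> bv.perp V2 = bv.perp H)"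
    proof
      assume p: "bw.perp W2 = {0} \<and> bv.perp V2 = bv.perp H"
      have "W2 = a.w.span BW" by (rule full) (use p d s in simp_all)
      moreover have "V2 = H" by (rule eq) (use p d s in simp_all)
      ultimately have "V1 = {0} \<and> W1 = L" using d(6,8) s' by auto
      then show False using d(10) by blast
    qed
  qed simp_all
qed

text \<open>Annihilators exchange hyperplanes and lines, hence the two options in
  \<open>peelable\<close>; a decomposition on this side would be carried by
  \<open>decomp_adjoint\<close> to one on the dual side.\<close>

lemma peelable_adjoint:
  assumes "a'.peelable (a.w.span BW) (a.v.span BV)"
  shows "a.peelable (a.v.span BV) (a.w.span BW)"
  using assms unfolding a'.peelable_def
proof (elim disjE exE bexE conjE)
  fix H x assume H: "a.w.subspace H" "x \<notin> H" "a.w.span (insert x H) = a.w.span BW"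
    "\<not> a'.decomp H (a.v.span BV) {0}"
  have sH: "H \<subseteq> a.w.span BW" "x \<in> a.w.span BW" using H(3) a.w.span_superset[of "insert x H"] by auto
  obtain y where y: "y \<in> bw.perp H" "bw.dot y x \<noteq> 0"
    using bw.perp_separates[OF H(1) sH H(2)] .
  have perp: "bw.perp H = a.w.span {y}"
  proof
    show "a.w.span {y} \<subseteq> bw.perp H" using y by (intro a.w.span_minimal) auto
    show "bw.perp H \<subseteq> a.w.span {y}"
    proof
      fix z assume z: "z \<in> bw.perp H"
      \<comment> \<open>The multiple of \<open>y\<close> is the one that agrees with
        \<open>z\<close> at \<open>x\<close>; the rest annihilates \<open>H\<close> and
        \<open>x\<close>, hence everything, and is 0.\<close>
      define r where "r = z - sy (bw.dot z x / bw.dot y x) y"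
      have "r \<in> bw.perp H" unfolding r_def using y z by (simp add: a.w.subspace_diff a.w.subspace_scale)
      moreover have "bw.dot r x = 0" using y by (simp add: r_def bw.dot_diff_left bw.dot_scale_left)
      ultimately have "r \<in> bw.perp (a.w.span (insert x H))"
        unfolding bw.perp_span by (auto simp: bw.perp_def)
      then have "z = sy (bw.dot z x / bw.dot y x) y" using H(3) bw.perp_full by (simp add: r_def)
      then show "z \<in> a.w.span {y}" by (metis a.w.span_base a.w.span_scale singletonI)
    qed
  qed
  have "\<not> a.decomp (a.v.span BV) (a.w.span BW) (a.w.span {y})"
  proof
    assume "a.decomp (a.v.span BV) (a.w.span BW) (a.w.span {y})"
    then have "a'.decomp (bw.perp (bw.perp H)) (a.v.span BV) (bv.perp (a.v.span BV))"
      using decomp_adjoint perp by simp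
    then show False using H(4) bw.perp_perp[OF H(1) sH(1)] bv.perp_full by simp
  qed
  moreover have "y \<noteq> 0" "y \<in> a.w.span BW" using y bw.perp_subset by auto
  ultimately show ?thesis unfolding a.peelable_def by blast
next
  fix y assume y: "y \<in> a.v.span BV" "y \<noteq> 0" "\<not> a'.decomp (a.w.span BW) (a.v.span BV) (a.v.span {y})"
  define H where "H = bv.perp {y}"
  obtain x where "x \<in> bv.perp {0}" "bv.dot x y \<noteq> 0"
    by (rule bv.perp_separates[of "{0}" y]) (use y a.v.span_zero in auto)
  then have x: "x \<in> a.v.span BV" "bv.dot x y \<noteq> 0" using bv.perp_subset by auto
  have xH: "x \<notin> H" using x by (simp add: H_def bv.perp_def)
  have "a.v.span (insert x H) = a.v.span BV"
  proof
    show "a.v.span (insert x H) \<subseteq> a.v.span BV"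
      using x bv.perp_subset by (intro a.v.span_minimal) (auto simp: H_def)
    show "a.v.span BV \<subseteq> a.v.span (insert x H)"
    proof
      fix z assume z: "z \<in> a.v.span BV"
      have "z - sx (bv.dot z y / bv.dot x y) x \<in> H"
        using x z by (simp add: H_def bv.perp_def bv.dot_diff_left bv.dot_scale_left a.v.span_diff a.v.span_scale)
      then show "z \<in> a.v.span (insert x H)"
        unfolding a.v.span_breakdown_eq using a.v.span_base by blast
    qed
  qed
  moreover have "\<not> a.decomp H (a.w.span BW) {0}"
  proof
    assume "a.decomp H (a.w.span BW) {0}"
    then have "a'.decomp (bw.perp {0}) (a.v.span BV) (bv.perp H)"
      using decomp_adjoint[of H] bv.perp_subset by (simp add: H_def)
    moreover have "bv.perp H = a.v.span {y}"
      using bv.perp_perp[of "a.v.span {y}"] y a.v.span_minimal[of "{y}" "a.v.span BV"]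
      by (simp add: H_def bv.perp_span)
    ultimately show False using y(3) bw.perp_zero by simp
  qed
  moreover have "a.v.subspace H" by (simp add: H_def)
  ultimately show ?thesis unfolding a.peelable_def using xH by blast
qed

end

section \<open>Transposed arrows and the reduction to \<open>dim V\<close> at most
  \<open>dim W\<close>\<close>

context indecomposable_maps
begin

lemma peelable_dual:
  obtains A' where "indecomposable_maps sy sx A' W V"
    and "arrow_maps.peelable sy sx A' W V \<longrightarrow> peelable V W"
proof -
  obtain BV where BV: "finite BV" "v.independent BV" "v.span BV = V"
    using v.fin_spanned_basis[OF V(2)] V(1) by (metis v.span_subspace_id)
  obtain BW where BW: "finite BW" "w.independent BW" "w.span BW = W"
    using w.fin_spanned_basis[OF W(2)] W(1) by (metis w.span_subspace_id)
  interpret bv: fin_basis sx BV using BV by unfold_locales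
  interpret bw: fin_basis sy BW using BW by unfold_locales
  \<comment> \<open>The transposed matrix: the coefficient at \<open>b\<close> is the value on
    \<open>A g b\<close> of the functional given by \<open>y\<close>.\<close>
  define A' where "A' g y = (\<Sum>b\<in>BV. sx (bw.dot y (A g b)) b)" for g y
  interpret a': arrow_maps sy sx A'
  proof unfold_locales
    fix g c x y
    show "A' g (x + y) = A' g x + A' g y"
      by (simp add: A'_def bw.dot_add_left v.scale_left_distrib sum.distrib)
    show "A' g (sy c x) = sx c (A' g x)"
      by (simp add: A'_def bw.dot_scale_left v.scale_sum_right)
  qed
  interpret ad: adjoint_maps sx sy A A' BV BW
  proof unfold_locales
    fix x g assume "x \<in> v.span BV"
    then show "A g x \<in> w.span BW" using AV BV BW by auto
  next
    fix y g show "A' g y \<in> v.span BV"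
      unfolding A'_def by (intro v.span_sum v.span_scale v.span_base)
  next
    fix x y g assume x: "x \<in> v.span BV"
    have A_sum: "A g (\<Sum>b\<in>I. sx (f b) b) = (\<Sum>b\<in>I. sy (f b) (A g b))" for f and I
      by (induction I rule: infinite_finite_induct) (auto simp: A_add A_scale)
    have dot_sum: "bw.dot y (\<Sum>b\<in>I. sy (f b) (A g b)) = (\<Sum>b\<in>I. f b * bw.dot y (A g b))" for f and I
      by (induction I rule: infinite_finite_induct) (auto simp: bw.dot_add_right bw.dot_scale_right)
    have "bv.dot (A' g y) x = (\<Sum>b\<in>BV. bw.dot y (A g b) * bv.dot b x)"
      by (simp add: A'_def bv.dot_sum_left bv.dot_scale_left)
    also have "\<dots> = (\<Sum>b\<in>BV. bv.dot x b * bw.dot y (A g b))"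
      by (simp add: bv.dot_commute mult.commute)
    also have "\<dots> = bw.dot y (A g (\<Sum>b\<in>BV. sx (bv.dot x b) b))"
      by (simp add: A_sum dot_sum)
    finally show "bv.dot (A' g y) x = bw.dot y (A g x)" using bv.span_expand[OF x] by simp
  qed
  have "indecomposable_maps sy sx A' W V"
  proof unfold_locales
    show "w.subspace W" "w.fin_spanned W" "W \<noteq> {0}" "v.subspace V" "v.fin_spanned V" "V \<noteq> {0}"
      using V W by auto
    show "A' g ` W \<subseteq> V" for g using ad.A'_span BV BW by auto
    interpret sw: adjoint_maps sy sx A' A BW BV by (rule ad.adjoint_swap)
    show "\<not> a'.decomp W V {0}"
    proof
      assume "a'.decomp W V {0}"
      then have "decomp (bv.perp {0}) (w.span BW) (bw.perp W)"
        using sw.decomp_adjoint[of W "{0}"] BV BW by simp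
      then show False using indec bv.perp_zero bw.perp_full BV BW by simp
    qed
  qed
  moreover have "a'.peelable W V \<longrightarrow> peelable V W"
    using ad.peelable_adjoint BV BW by simp
  ultimately show ?thesis using that by blast
qed

lemma peelable_small_le:
  assumes "v.dim V \<le> w.dim W" "v.dim V + w.dim W \<le> 6"
    and quad: "\<And>x y z :: 'k. \<exists>t. (x + t) * (y + t) \<noteq> z"
  shows "peelable V W"
proof -
  have "v.dim V = 1 \<or> v.dim V = 2 \<and> w.dim W = 2 \<or> v.dim V = 2 \<and> w.dim W = 3 \<or>
    v.dim V = 2 \<and> w.dim W = 4 \<or> v.dim V = 3 \<and> w.dim W = 3"
    using assms(1,2) dim_V_pos by arith
  then show ?thesis
    using peelable_dim1 peelable_2_2 peelable_2_3[OF _ _ quad] peelable_2_4 peelable_3_3 by blast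
qed

lemma peelable_small:
  assumes "v.dim V + w.dim W \<le> 6"
    and quad: "\<And>x y z :: 'k. \<exists>t. (x + t) * (y + t) \<noteq> z"
  shows "peelable V W"
proof (cases "v.dim V \<le> w.dim W")
  case True
  then show ?thesis using peelable_small_le assms by blast
next
  case False
  obtain A' where A': "indecomposable_maps sy sx A' W V"
    "arrow_maps.peelable sy sx A' W V \<longrightarrow> peelable V W"
    using peelable_dual by blast
  interpret d: indecomposable_maps sy sx A' W V by (rule A'(1))
  show ?thesis
    using A'(2) d.peelable_small_le[OF _ _ quad] False assms(1) by simp
qed

end

section \<open>Representations\<close>

text \<open>The arrows of a representation are linear only on its own space, whereas
  \<open>arrow_maps\<close> works with maps linear on the whole type.\<close>

lemma (in kronecker3) linear_between_extend:
  assumes "vs1.subspace V" "linear_between sx sy V W f"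
  obtains g where "Vector_Spaces.linear sx sy g" "\<And>v. v \<in> V \<Longrightarrow> g v = f v"
proof -
  obtain B where B: "B \<subseteq> V" "vs1.independent B" "V \<subseteq> vs1.span B"
    using vs1.maximal_independent_subset by blast
  then have VB: "V = vs1.span B" using assms(1) vs1.span_minimal by blast
  have f: "f (u + v) = f u + f v" "f (sx c v) = sy c (f v)" if "u \<in> V" "v \<in> V" for u v c
    using assms(2) that by (auto simp: linear_between_def)
  have "0 \<in> V" using assms(1) vs1.subspace_0 by blast
  then have f0: "f 0 = 0" using f(2)[of 0 0 0] by simp
  define g where "g = construct B f"
  have lin: "Vector_Spaces.linear sx sy g"
    unfolding g_def by (rule linear_construct[OF B(2)])
  interpret g: Vector_Spaces.linear sx sy g by (rule lin)
  have "v \<in> V \<and> g v = f v" if "v \<in> vs1.span B" for v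
    using that
  proof (induction rule: vs1.span_induct_alt)
    case base
    then show ?case using \<open>0 \<in> V\<close> by (simp add: f0)
  next
    case (step c b y)
    then have "b \<in> V" "y \<in> V" "sx c b \<in> V"
      using B(1) assms(1) vs1.subspace_scale by auto
    moreover from this have "sx c b + y \<in> V" using assms(1) vs1.subspace_add by blast
    ultimately show ?case
      using step f construct_basis[OF B(2), of b f] by (simp add: g.add g.scale g_def[symmetric])
  qed
  then have "g v = f v" if "v \<in> V" for v using that VB by blast
  then show ?thesis using that lin by blast
qed

locale kronecker_arrows = arrow_maps sx sy A + kronecker3 sx sy
  for sx :: "'k::field \<Rightarrow> 'a::ab_group_add \<Rightarrow> 'a"
    and sy :: "'k \<Rightarrow> 'b::ab_group_add \<Rightarrow> 'b"
    and A :: "arrow \<Rightarrow> 'a \<Rightarrow> 'b"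
begin

lemma is_repI:
  assumes "v.subspace V" "w.subspace W" "\<And>g x. x \<in> V \<Longrightarrow> A g x \<in> W"
  shows "is_rep \<lparr>space_x = V, space_y = W, act = A\<rparr>"
  using assms by (auto simp: is_rep_def linear_between_def A_add A_scale)

lemma subrep_restrict:
  assumes "is_rep M" "\<And>g x. x \<in> space_x M \<Longrightarrow> act M g x = A g x"
    and "v.subspace V" "w.subspace W" "V \<subseteq> space_x M" "W \<subseteq> space_y M"
    and "\<And>g x. x \<in> V \<Longrightarrow> A g x \<in> W"
  shows "subrep \<lparr>space_x = V, space_y = W, act = A\<rparr> M"
  using assms is_repI[of V W] unfolding subrep_def by auto

text \<open>Values of \<open>act M\<close> outside \<open>space_x M\<close> do not matter, so both
  summands may carry the globally linear \<open>A\<close>; with \<open>L = {0}\<close>,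
  \<open>decomp\<close> is then a direct sum of subrepresentations.\<close>

lemma indecomposable_iff:
  assumes M: "is_rep M" "\<And>g x. x \<in> space_x M \<Longrightarrow> act M g x = A g x"
  shows "indecomposable M \<longleftrightarrow> \<not> is_zero M \<and> \<not> decomp (space_x M) (space_y M) {0}"
proof -
  have dec: "decomp (space_x M) (space_y M) {0}"
    if ds: "direct_sum M N1 N2" and nz: "\<not> is_zero N1" "\<not> is_zero N2" for N1 N2
  proof -
    have s: "subrep N1 M" "subrep N2 M" using ds by (auto simp: direct_sum_def)
    then have sub: "v.subspace (space_x N1)" "v.subspace (space_x N2)"
      "w.subspace (space_y N1)" "w.subspace (space_y N2)"
      by (auto simp: subrep_def is_rep_def)
    have act: "A g x \<in> space_y N" if "subrep N M" "x \<in> space_x N" for N g x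
    proof -
      have "act N g x \<in> space_y N"
        using that unfolding subrep_def is_rep_def linear_between_def by blast
      moreover have "act N g x = A g x" using that M(2) by (auto simp: subrep_def)
      ultimately show ?thesis by simp
    qed
    show ?thesis
    proof (rule decompI[OF sub])
      show "v.span (space_x N1 \<union> space_x N2) = space_x M"
        using ds sub by (simp add: v.span_Un direct_sum_def)
      show "w.span (space_y N1 \<union> space_y N2) = space_y M"
        using ds sub by (simp add: w.span_Un direct_sum_def)
    qed (use ds act s nz in \<open>auto simp: direct_sum_def is_zero_def\<close>)
  qed
  have ds: "\<exists>N1 N2. direct_sum M N1 N2 \<and> \<not> is_zero N1 \<and> \<not> is_zero N2"
    if D: "decomp (space_x M) (space_y M) {0}"
  proof -
    obtain V1 V2 W1 W2 where d:
      "v.subspace V1" "v.subspace V2" "w.subspace W1" "w.subspace W2"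
      "v.span (V1 \<union> V2) = space_x M" "V1 \<inter> V2 = {0}"
      "w.span (W1 \<union> W2) = space_y M" "W1 \<inter> W2 = {0}"
      "\<forall>\<gamma>. A \<gamma> ` V1 \<subseteq> W1 \<and> A \<gamma> ` V2 \<subseteq> W2"
      "\<not> (V1 = {0} \<and> W1 = {0})" "\<not> (V2 = {0} \<and> W2 = {0})"
      using D unfolding decomp_def by (elim exE conjE)
    have s: "V1 \<subseteq> space_x M" "V2 \<subseteq> space_x M" "W1 \<subseteq> space_y M" "W2 \<subseteq> space_y M"
      using d(5,7) v.span_superset[of "V1 \<union> V2"] w.span_superset[of "W1 \<union> W2"] by auto
    have a: "A g x \<in> W1" if "x \<in> V1" for g x using d(9) that by blast
    have a': "A g x \<in> W2" if "x \<in> V2" for g x using d(9) that by blast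
    have "direct_sum M \<lparr>space_x = V1, space_y = W1, act = A\<rparr> \<lparr>space_x = V2, space_y = W2, act = A\<rparr>"
      unfolding direct_sum_def
      using subrep_restrict[OF M d(1,3) s(1,3) a] subrep_restrict[OF M d(2,4) s(2,4) a']
        d(5,7) v.span_Un[of V1 V2] w.span_Un[of W1 W2] d(1-4,6,8)
      by simp
    then show ?thesis using d(10,11)
      by (intro exI conjI) (auto simp: is_zero_def)
  qed
  show ?thesis
    unfolding indecomposable_def using M(1) dec ds by blast
qed

lemma simple_x:
  assumes "is_rep M" "x \<noteq> 0" "space_x M = v.span {x}" "space_y M = {0}"
  shows "simple M"
  unfolding simple_def
proof (intro conjI allI impI)
  show "is_rep M" by fact
  show "\<not> is_zero M" using assms v.span_base[of x "{x}"] by (auto simp: is_zero_def)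
  fix N assume "subrep N M"
  then have N: "v.subspace (space_x N)" "w.subspace (space_y N)" "space_x N \<subseteq> v.span {x}" "space_y N \<subseteq> {0}"
    using assms by (auto simp: subrep_def is_rep_def)
  then have y: "space_y N = {0}" using w.subspace_0 by blast
  show "is_zero N \<or> space_x N = space_x M \<and> space_y N = space_y M"
  proof (cases "space_x N = {0}")
    case False
    then obtain z where z: "z \<in> space_x N" "z \<noteq> 0" using v.subspace_0[OF N(1)] by blast
    then have "v.span {z} = v.span {x}" using N by (intro v.span_single_eq) auto
    moreover have "v.span {z} \<subseteq> space_x N" using z N by (intro v.span_minimal) auto
    ultimately show ?thesis using N(3) y assms by auto
  qed (simp add: is_zero_def y)
qed

lemma simple_y:
  assumes "is_rep M" "y \<noteq> 0" "space_x M = {0}" "space_y M = w.span {y}"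
  shows "simple M"
  unfolding simple_def
proof (intro conjI allI impI)
  show "is_rep M" by fact
  show "\<not> is_zero M" using assms w.span_base[of y "{y}"] by (auto simp: is_zero_def)
  fix N assume "subrep N M"
  then have N: "v.subspace (space_x N)" "w.subspace (space_y N)" "space_y N \<subseteq> w.span {y}" "space_x N \<subseteq> {0}"
    using assms by (auto simp: subrep_def is_rep_def)
  then have x: "space_x N = {0}" using v.subspace_0 by blast
  show "is_zero N \<or> space_x N = space_x M \<and> space_y N = space_y M"
  proof (cases "space_y N = {0}")
    case False
    then obtain z where z: "z \<in> space_y N" "z \<noteq> 0" using w.subspace_0[OF N(2)] by blast
    then have "w.span {z} = w.span {y}" using N by (intro w.span_single_eq) auto
    moreover have "w.span {z} \<subseteq> space_y N" using z N by (intro w.span_minimal) auto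
    ultimately show ?thesis using N(3) x assms by auto
  qed (simp add: is_zero_def x)
qed

lemma simple_imp_indecomposable:
  assumes "simple M"
  shows "indecomposable M"
  unfolding indecomposable_def
proof (intro conjI allI impI)
  show "is_rep M" "\<not> is_zero M" using assms by (auto simp: simple_def)
  fix N1 N2 assume d: "direct_sum M N1 N2"
  then consider "is_zero N1" | "space_x N1 = space_x M" "space_y N1 = space_y M"
    using assms by (auto simp: direct_sum_def simple_def)
  then show "is_zero N1 \<or> is_zero N2"
  proof cases
    case 2
    then have "is_zero N2" using d by (auto simp: direct_sum_def subrep_def is_zero_def)
    then show ?thesis ..
  qed simp
qed

text \<open>If one space is zero, the arrows vanish and any splitting of the other space decomposes
  \<open>M\<close>. That space is then a line, and \<open>M\<close> would be simple.\<close>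

lemma spaces_nonzero:
  assumes M: "is_rep M" "\<And>g x. x \<in> space_x M \<Longrightarrow> act M g x = A g x"
    and "indecomposable M" "\<not> simple M"
  shows "space_x M \<noteq> {0}" "space_y M \<noteq> {0}"
proof -
  have nz: "\<not> is_zero M" and nd: "\<not> decomp (space_x M) (space_y M) {0}"
    using indecomposable_iff[OF M] assms by auto
  have sub: "v.subspace (space_x M)" "w.subspace (space_y M)"
    and act: "A g x \<in> space_y M" if "x \<in> space_x M" for g x
    using M that unfolding is_rep_def linear_between_def by fastforce+
  show "space_y M \<noteq> {0}"
  proof
    assume 0: "space_y M = {0}"
    have sub: "v.subspace (space_x M)" using M(1) by (simp add: is_rep_def)
    obtain x where x: "x \<in> space_x M" "x \<noteq> 0" using nz 0 v.subspace_0[OF sub] by (auto simp: is_zero_def)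
    have "v.span {x} \<subseteq> space_x M" using x sub by (intro v.span_minimal) auto
    then obtain C where C: "v.subspace C" "C \<subseteq> space_x M" "v.span {x} \<inter> C = {0}"
      "v.span (v.span {x} \<union> C) = space_x M"
      using v.complement_exists[of "v.span {x}" "space_x M"] sub by auto
    have "space_x M \<noteq> v.span {x}" using simple_x[OF M(1) x(2) _ 0] assms(4) by blast
    then have "C \<noteq> {0}" using C(4) by (metis Un_empty_right Un_insert_right v.span_insert_0 v.span_span)
    moreover have "v.span {x} \<noteq> {0}" using x v.span_base[of x "{x}"] by auto
    moreover have "A g z = 0" if "z \<in> space_x M" for g z using act[OF that] 0 by simp
    ultimately have "decomp (space_x M) {0} {0}"
      using C \<open>v.span {x} \<subseteq> _\<close> by (intro decompI[of "v.span {x}" C "{0}" "{0}"]) auto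
    then show False using nd 0 by simp
  qed
  show "space_x M \<noteq> {0}"
  proof
    assume 0: "space_x M = {0}"
    have sub: "w.subspace (space_y M)" using M(1) by (simp add: is_rep_def)
    obtain y where y: "y \<in> space_y M" "y \<noteq> 0" using nz 0 w.subspace_0[OF sub] by (auto simp: is_zero_def)
    have "w.span {y} \<subseteq> space_y M" using y sub by (intro w.span_minimal) auto
    then obtain C where C: "w.subspace C" "C \<subseteq> space_y M" "w.span {y} \<inter> C = {0}"
      "w.span (w.span {y} \<union> C) = space_y M"
      using w.complement_exists[of "w.span {y}" "space_y M"] sub by auto
    have "space_y M \<noteq> w.span {y}" using simple_y[OF M(1) y(2) 0] assms(4) by blast
    then have "C \<noteq> {0}" using C(4) by (metis Un_empty_right Un_insert_right w.span_insert_0 w.span_span)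
    moreover have "w.span {y} \<noteq> {0}" using y w.span_base[of y "{y}"] by auto
    ultimately have "decomp {0} (space_y M) {0}"
      using C w.subspace_0 by (intro decompI[of "{0}" "{0}" "w.span {y}" C]) (auto simp: w.span_zero)
    then show False using nd 0 by simp
  qed
qed

section \<open>Exact sequences from hyperplanes and lines\<close>

lemma short_exact_hyperplane:
  assumes M: "is_rep M" "\<And>g x. x \<in> space_x M \<Longrightarrow> act M g x = A g x"
    and W: "space_y M \<noteq> {0}"
    and H: "v.subspace H" "x \<notin> H" "v.span (insert x H) = space_x M"
    and nd: "\<not> decomp H (space_y M) {0}"
  shows "\<exists>U1 f g U2. short_exact U1 f M g U2 \<and> indecomposable U1 \<and> indecomposable U2 \<and> simple U2"
proof -
  have sM: "v.subspace (space_x M)" "w.subspace (space_y M)"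
    using M(1) by (auto simp: is_rep_def)
  have HM: "H \<subseteq> space_x M" "x \<in> space_x M" using H(3) v.span_superset[of "insert x H"] by auto
  have act: "A g z \<in> space_y M" if "z \<in> space_x M" for g z
    using M that unfolding is_rep_def linear_between_def by fastforce
  have int: "H \<inter> v.span {x} = {0}" using v.span_Int_single[OF H(1,2)] by blast
  \<comment> \<open>The projection along \<open>H\<close> realises the quotient by \<open>H\<close>
    on the line of \<open>x\<close>; it is the surjection onto the simple term.\<close>
  obtain p where p: "Vector_Spaces.linear sx sx p" "\<And>z. z \<in> H \<Longrightarrow> p z = 0"
    "\<And>z. z \<in> v.span {x} \<Longrightarrow> p z = z"
    using v.projection_exists[OF H(1) v.subspace_span v.fin_spanned_span[THEN iffD2, OF v.fin_spanned_finite] int]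
    by auto
  interpret p: Vector_Spaces.linear sx sx p by (rule p(1))
  have dec: "\<exists>h c. z = h + sx c x \<and> h \<in> H" if z: "z \<in> space_x M" for z
  proof -
    obtain c where "z - sx c x \<in> H"
      using z H(1) unfolding H(3)[symmetric] v.span_breakdown_eq by auto
    then show ?thesis by (intro exI[of _ "z - sx c x"] exI[of _ c]) simp
  qed
  have px: "p (h + sx c x) = sx c x" if "h \<in> H" for h c
    using p(2)[OF that] p(3)[of "sx c x"] by (simp add: p.add v.span_base v.span_scale)
  define U1 where "U1 = \<lparr>space_x = H, space_y = space_y M, act = A\<rparr>"
  define U2 :: "('a, 'b) krep" where "U2 = \<lparr>space_x = v.span {x}, space_y = {0}, act = \<lambda>_ _. 0\<rparr>"
  have U1: "is_rep U1" unfolding U1_def using H HM act sM by (intro is_repI) auto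
  have U2: "is_rep U2" by (auto simp: U2_def is_rep_def linear_between_def)
  have "indecomposable U1"
    using indecomposable_iff[of U1] U1 nd W by (auto simp: U1_def is_zero_def)
  moreover have "x \<noteq> 0" using H v.subspace_0 by blast
  then have "simple U2" using simple_x[OF U2, of x] by (simp add: U2_def)
  moreover have "short_exact U1 (id, id) M (p, \<lambda>_. 0) U2"
    unfolding short_exact_def rep_hom_def
  proof (intro conjI)
    show "is_rep U1" "is_rep M" "is_rep U2" "is_rep M" using U1 U2 M by auto
    show "linear_between sx sx (space_x U1) (space_x M) (fst (id, id))"
      "linear_between sy sy (space_y U1) (space_y M) (snd (id, id))"
      using HM by (auto simp: linear_between_def U1_def)
    show "\<forall>\<gamma>. \<forall>v\<in>space_x U1. snd (id, id) (act U1 \<gamma> v) = act M \<gamma> (fst (id, id) v)"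
      using HM M(2) by (auto simp: U1_def)
    show "linear_between sx sx (space_x M) (space_x U2) (fst (p, \<lambda>_. 0))"
      using dec px by (fastforce simp: linear_between_def U2_def p.add p.scale v.span_base v.span_scale)
    show "linear_between sy sy (space_y M) (space_y U2) (snd (p, \<lambda>_. 0))"
      by (auto simp: linear_between_def U2_def)
    show "\<forall>\<gamma>. \<forall>v\<in>space_x M. snd (p, \<lambda>_. 0) (act M \<gamma> v) = act U2 \<gamma> (fst (p, \<lambda>_. 0) v)"
      by (auto simp: U2_def)
    show "inj_on (fst (id, id)) (space_x U1)" "inj_on (snd (id, id)) (space_y U1)" by auto
    show "fst (id, id) ` space_x U1 = {v \<in> space_x M. fst (p, \<lambda>_. 0 :: 'b) v = 0}"
    proof
      show "fst (id, id) ` space_x U1 \<subseteq> {v \<in> space_x M. fst (p, \<lambda>_. 0 :: 'b) v = 0}"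
        using HM p(2) by (auto simp: U1_def)
      show "{v \<in> space_x M. fst (p, \<lambda>_. 0 :: 'b) v = 0} \<subseteq> fst (id, id) ` space_x U1"
      proof
        fix z assume z: "z \<in> {v \<in> space_x M. fst (p, \<lambda>_. 0 :: 'b) v = 0}"
        then obtain h c where "z = h + sx c x" "h \<in> H" using dec by blast
        then show "z \<in> fst (id, id) ` space_x U1" using z px[of h c] by (auto simp: U1_def)
      qed
    qed
    show "snd (id, id) ` space_y U1 = {v \<in> space_y M. snd (p, \<lambda>_. 0 :: 'b) v = 0}"
      by (auto simp: U1_def)
    show "fst (p, \<lambda>_. 0) ` space_x M = space_x U2"
    proof
      show "fst (p, \<lambda>_. 0) ` space_x M \<subseteq> space_x U2"
        using dec px by (fastforce simp: U2_def v.span_base v.span_scale)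
      have "v.span {x} \<subseteq> space_x M" using HM sM by (intro v.span_minimal) auto
      then show "space_x U2 \<subseteq> fst (p, \<lambda>_. 0) ` space_x M"
        using p(3) by (force simp: U2_def)
    qed
    show "snd (p, \<lambda>_. 0) ` space_y M = space_y U2"
      using w.subspace_0[OF sM(2)] by (auto simp: U2_def)
  qed
  ultimately show ?thesis using simple_imp_indecomposable by blast
qed

text \<open>The quotient of \<open>space_y M\<close> by the line of \<open>y\<close> is realised on
  a complement \<open>C\<close>, with the arrows followed by the projection onto \<open>C\<close>. A
  decomposition of it lifts to one modulo the line by taking preimages.\<close>

lemma short_exact_quotient:
  assumes M: "is_rep M" "\<And>g x. x \<in> space_x M \<Longrightarrow> act M g x = A g x"
    and V: "space_x M \<noteq> {0}" and fin: "w.fin_spanned (space_y M)"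
    and y: "y \<in> space_y M" "y \<noteq> 0"
    and nd: "\<not> decomp (space_x M) (space_y M) (w.span {y})"
  shows "\<exists>U1 f g U2. short_exact U1 f M g U2 \<and> indecomposable U1 \<and> indecomposable U2 \<and> simple U1"
proof -
  let ?V = "space_x M" and ?W = "space_y M"
  have sM: "v.subspace ?V" "w.subspace ?W"
    using M(1) by (auto simp: is_rep_def)
  have act: "A g z \<in> ?W" if "z \<in> ?V" for g z
    using M that unfolding is_rep_def linear_between_def by fastforce
  have yW: "w.span {y} \<subseteq> ?W" using y sM by (intro w.span_minimal) auto
  then obtain C where C: "w.subspace C" "C \<subseteq> ?W" "w.span {y} \<inter> C = {0}"
    "w.span (w.span {y} \<union> C) = ?W"
    using w.complement_exists[of "w.span {y}" ?W] sM by auto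
  obtain p where p: "Vector_Spaces.linear sy sy p" "\<And>z. z \<in> w.span {y} \<Longrightarrow> p z = 0"
    "\<And>z. z \<in> C \<Longrightarrow> p z = z"
    using w.projection_exists[OF w.subspace_span C(1) w.fin_spanned_subset[OF fin C(2)] C(3)]
    by auto
  interpret p: Vector_Spaces.linear sy sy p by (rule p(1))
  have pC: "p z \<in> C \<and> z - p z \<in> w.span {y}" if "z \<in> ?W" for z
  proof -
    have "z \<in> w.span (w.span {y} \<union> C)" using that C(4) by simp
    then obtain a b where "z = a + b" "a \<in> w.span {y}" "b \<in> C"
      unfolding w.span_Un using C(1) by (auto simp: w.span_span)
    then show ?thesis using p(2,3) by (simp add: p.add)
  qed
  have ker: "z \<in> w.span {y}" if "z \<in> ?W" "p z = 0" for z using pC[OF that(1)] that(2) by simp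
  define A2 where "A2 g z = p (A g z)" for g z
  interpret A2: kronecker_arrows sx sy A2
  proof unfold_locales
    fix g c x z
    show "A2 g (x + z) = A2 g x + A2 g z" "A2 g (sx c x) = sy c (A2 g x)"
      by (simp_all add: A2_def A_add A_scale p.add p.scale)
  qed
  have nd2: "\<not> A2.decomp ?V C {0}"
  proof
    assume "A2.decomp ?V C {0}"
    then obtain V1 V2 W1 W2 where d:
      "v.subspace V1" "v.subspace V2" "w.subspace W1" "w.subspace W2"
      "v.span (V1 \<union> V2) = ?V" "V1 \<inter> V2 = {0}" "w.span (W1 \<union> W2) = C" "W1 \<inter> W2 = {0}"
      "\<forall>\<gamma>. A2 \<gamma> ` V1 \<subseteq> W1 \<and> A2 \<gamma> ` V2 \<subseteq> W2"
      "\<not> (V1 = {0} \<and> W1 = {0})" "\<not> (V2 = {0} \<and> W2 = {0})"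
      unfolding A2.decomp_def by (elim exE conjE)
    have s: "V1 \<subseteq> ?V" "V2 \<subseteq> ?V" "W1 \<subseteq> C" "W2 \<subseteq> C"
      using d(5,7) v.span_superset[of "V1 \<union> V2"] w.span_superset[of "W1 \<union> W2"] by auto
    \<comment> \<open>Preimages under the projection contain its kernel, the line of
      \<open>y\<close>; hence those of \<open>W1\<close> and \<open>W2\<close> meet in exactly that
      line.\<close>
    define X where "X Y = {z \<in> ?W. p z \<in> Y}" for Y
    have X_sub: "w.subspace (X Y)" if "w.subspace Y" for Y
      using that sM(2) by (auto simp: X_def w.subspace_def p.add p.scale)
    have X_in: "Y \<subseteq> X Y" if "Y \<subseteq> C" for Y
      using that C(2) p(3) by (auto simp: X_def)
    have X_triv: "Y = {0}" if "X Y = w.span {y}" "Y \<subseteq> C" "w.subspace Y" for Y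
      using X_in[OF that(2)] that C(3) w.subspace_0 by blast
    have A_X: "A g z \<in> X Y" if "z \<in> Z" "Z \<subseteq> ?V" "\<forall>g. A2 g ` Z \<subseteq> Y" for g z Y Z
      using that act by (auto simp: X_def A2_def image_subset_iff)
    have "decomp ?V ?W (w.span {y})"
    proof (rule decompI[OF d(1,2) X_sub[OF d(3)] X_sub[OF d(4)] d(5,6)])
      show "w.span (X W1 \<union> X W2) = ?W"
      proof
        show "w.span (X W1 \<union> X W2) \<subseteq> ?W" using sM(2) by (intro w.span_minimal) (auto simp: X_def)
        show "?W \<subseteq> w.span (X W1 \<union> X W2)"
        proof
          fix z assume z: "z \<in> ?W"
          then have "p z \<in> w.span (W1 \<union> W2)" using pC d(7) by simp
          then obtain a b where ab: "p z = a + b" "a \<in> W1" "b \<in> W2"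
            using w.span_Un[of W1 W2] d(3,4) by auto
          have "a \<in> X W1" using X_in s ab by blast
          moreover have "z - a \<in> X W2"
            using z ab s C(2) sM(2) p(3)[of a] by (auto simp: X_def p.diff w.subspace_diff)
          ultimately have "a + (z - a) \<in> w.span (X W1 \<union> X W2)" by (intro w.span_add w.span_base) auto
          then show "z \<in> w.span (X W1 \<union> X W2)" by simp
        qed
      qed
      show "X W1 \<inter> X W2 = w.span {y}"
        using d(3,4,8) yW p(2) ker w.subspace_0 by (auto simp: X_def)
      show "A g z \<in> X W1" if "z \<in> V1" for g z by (rule A_X[OF that s(1)]) (use d(9) in simp)
      show "A g z \<in> X W2" if "z \<in> V2" for g z by (rule A_X[OF that s(2)]) (use d(9) in simp)
      show "\<not> (V1 = {0} \<and> X W1 = w.span {y})" using X_triv[of W1] d(3,10) s by blast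
      show "\<not> (V2 = {0} \<and> X W2 = w.span {y})" using X_triv[of W2] d(4,11) s by blast
    qed
    then show False using nd by blast
  qed
  define U1 where "U1 = \<lparr>space_x = {0}, space_y = w.span {y}, act = A\<rparr>"
  define U2 where "U2 = \<lparr>space_x = ?V, space_y = C, act = A2\<rparr>"
  have U1: "is_rep U1" unfolding U1_def by (intro is_repI) (auto simp: w.span_zero)
  have U2: "is_rep U2" unfolding U2_def using sM C pC act by (intro A2.is_repI) (auto simp: A2_def)
  have "indecomposable U2"
    using A2.indecomposable_iff[of U2] U2 nd2 V by (auto simp: U2_def is_zero_def)
  moreover have "simple U1" using simple_y[OF U1 y(2)] by (simp add: U1_def)
  moreover have "short_exact U1 (id, id) M (id, p) U2"
    unfolding short_exact_def rep_hom_def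
  proof (intro conjI)
    show "is_rep U1" "is_rep M" "is_rep U2" "is_rep M" using U1 U2 M by auto
    show "linear_between sx sx (space_x U1) ?V (fst (id, id))"
      "linear_between sy sy (space_y U1) ?W (snd (id, id))"
      using yW v.subspace_0[OF sM(1)] by (auto simp: linear_between_def U1_def)
    show "\<forall>\<gamma>. \<forall>v\<in>space_x U1. snd (id, id) (act U1 \<gamma> v) = act M \<gamma> (fst (id, id) v)"
      using M(2) v.subspace_0[OF sM(1)] by (auto simp: U1_def)
    show "linear_between sx sx ?V (space_x U2) (fst (id, p))"
      by (auto simp: linear_between_def U2_def)
    show "linear_between sy sy ?W (space_y U2) (snd (id, p))"
      using pC by (auto simp: linear_between_def U2_def p.add p.scale)
    show "\<forall>\<gamma>. \<forall>v\<in>?V. snd (id, p) (act M \<gamma> v) = act U2 \<gamma> (fst (id, p) v)"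
      using M(2) by (auto simp: U2_def A2_def)
    show "inj_on (fst (id, id)) (space_x U1)" "inj_on (snd (id, id)) (space_y U1)" by auto
    show "fst (id, id) ` space_x U1 = {v \<in> ?V. fst (id, p) v = 0}"
      using v.subspace_0[OF sM(1)] by (auto simp: U1_def)
    show "snd (id, id) ` space_y U1 = {v \<in> ?W. snd (id, p) v = 0}"
      using yW p(2) ker by (auto simp: U1_def)
    show "fst (id, p) ` ?V = space_x U2" by (simp add: U2_def)
    show "snd (id, p) ` ?W = space_y U2"
      using pC p(3) C(2) by (force simp: U2_def)
  qed
  ultimately show ?thesis using simple_imp_indecomposable by blast
qed

end

lemma (in kronecker3) kronecker_arrows_exist:
  assumes "is_rep M"
  shows "\<exists>A. kronecker_arrows sx sy A \<and> (\<forall>g. \<forall>x\<in>space_x M. act M g x = A g x)"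
proof -
  have "\<exists>f. Vector_Spaces.linear sx sy f \<and> (\<forall>x\<in>space_x M. f x = act M g x)" for g
    using assms linear_between_extend[of "space_x M" "space_y M" "act M g"] unfolding is_rep_def by metis
  then obtain A where A: "\<And>g. Vector_Spaces.linear sx sy (A g)"
    "\<And>g x. x \<in> space_x M \<Longrightarrow> act M g x = A g x" by metis
  have "kronecker_arrows sx sy A"
    by unfold_locales (use A(1) in \<open>simp_all add: Vector_Spaces.linear_iff\<close>)
  then show ?thesis using A(2) by blast
qed

lemma alg_closed_quadratic:
  fixes x y z :: "'k::alg_closed_field"
  shows "\<exists>t. (x + t) * (y + t) \<noteq> z"
proof -
  \<comment> \<open>The polynomial is \<open>(x + t) * (y + t) - (z + 1)\<close>: at a root the
    product takes the value \<open>z + 1\<close>, which differs from \<open>z\<close>.\<close>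
  have "\<exists>t. poly [:x * y - z - 1, x + y, 1:] t = 0"
    by (rule alg_closed_imp_poly_has_root) simp
  then obtain t where "x * y - z - 1 + t * (x + y + t) = 0" by auto
  then have "(x + t) * (y + t) = z + 1" by (simp add: algebra_simps)
  then show ?thesis by (intro exI[of _ t]) simp
qed

theorem mainTheorem7:
  fixes sx :: "'k::alg_closed_field \<Rightarrow> 'a::ab_group_add \<Rightarrow> 'a"
    and sy :: "'k \<Rightarrow> 'b::ab_group_add \<Rightarrow> 'b"
    and M :: "('a, 'b) krep"
  assumes "kronecker3 sx sy"
    and "kronecker3.indecomposable sx sy M"
    and "\<not> kronecker3.simple sx sy M"
    and "kronecker3.fin_dim sx sy M"
    and "kronecker3.dim_rep sx sy M \<le> 6"
  shows "\<exists>U1 f g U2.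
    kronecker3.short_exact sx sy U1 f M g U2 \<and>
    kronecker3.indecomposable sx sy U1 \<and>
    kronecker3.indecomposable sx sy U2 \<and>
    (kronecker3.simple sx sy U1 \<or> kronecker3.simple sx sy U2)"
proof -
  obtain A where A: "kronecker_arrows sx sy A" "\<And>g x. x \<in> space_x M \<Longrightarrow> act M g x = A g x"
    and rep: "kronecker3.is_rep sx sy M"
    using kronecker3.kronecker_arrows_exist[OF assms(1)] assms(1,2) kronecker3.indecomposable_def by metis
  interpret kronecker_arrows sx sy A by (rule A(1))
  note M = rep A(2)
  note nz = spaces_nonzero[OF M assms(2,3)]
  have fin: "v.fin_spanned (space_x M)" "w.fin_spanned (space_y M)"
    using assms(4) unfolding fin_dim_def v.fin_spanned_def w.fin_spanned_def by auto
  interpret indecomposable_maps sx sy A "space_x M" "space_y M"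
  proof unfold_locales
    show "v.subspace (space_x M)" "w.subspace (space_y M)" using rep by (auto simp: is_rep_def)
    show "v.fin_spanned (space_x M)" "w.fin_spanned (space_y M)" "space_x M \<noteq> {0}" "space_y M \<noteq> {0}"
      using fin nz by auto
    show "A g ` space_x M \<subseteq> space_y M" for g
      using M unfolding is_rep_def linear_between_def by fastforce
    show "\<not> decomp (space_x M) (space_y M) {0}" using indecomposable_iff[OF M] assms(2) by blast
  qed
  have "peelable (space_x M) (space_y M)"
    using peelable_small[OF _ alg_closed_quadratic] assms(5) by (simp add: dim_rep_def)
  then show ?thesis
    unfolding peelable_def
    using short_exact_hyperplane[OF M nz(2)] short_exact_quotient[OF M nz(1) fin(2)] by blast
qed

end
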